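(* Let $G$ be a connected negative definite plumbing tree (all genera $0$) with exactly two nodes $E_0$, $\widetilde E_0$. For any $h\in H$, and any lift $\mathbf c=(c_0,\widetilde c_0,\overline c,c_i,\widetilde c_j)$ of $h$, one has $$Z_h(t,\widetilde t)=\sum_{(\ell,\widetilde\ell)\in\mathcal S_{\mathbf c}}t^{\ell+c}\,\widetilde t^{\,\widetilde\ell+\widetilde c},$$ where $$\mathcal S_{\mathbf c}=\big\{(\ell,\widetilde\ell)\in\mathbb Z^2:\ N_{\mathbf c}(\ell,\widetilde\ell)\ge0,\ \widetilde N_{\mathbf c}(\ell,\widetilde\ell)\ge0\ \text{ and }\ \ell+\widetilde\omega_0\widetilde\ell\equiv\overline c\ (\mathrm{mod}\ \alpha_0)\big\}.$$
   Context: **Graph.** $G$ has exactly two vertices of valency $\ge3$ (nodes), $E_0$ and $\widetilde E_0$ (vertices are denoted by their base elements), with decorations $b_0,\widetilde b_0$. $E_0$ has $d\ge2$ legs with end-vertices $E_1,\dots,E_d$; $\widetilde E_0$ has $\widetilde d\ge2$ legs with end-vertices $\widetilde E_1,\dots,\widetilde E_{\widetilde d}$; the nodes are connected by a chain with vertices $\overline E_1,\dots,\overline E_s$ ($s\ge1$), $\overline E_1$ adjacent to $E_0$, $\overline E_s$ adjacent to $\widetilde E_0$. If the vertices of a leg, starting from the one adjacent to the node, have decorations $-\beta_1,\dots,-\beta_\nu$ ($\beta_k\ge2$), its normalized Seifert invariant is $(\alpha,\omega)$ with $\alpha/\omega=\beta_1-1/(\beta_2-1/(\cdots-1/\beta_\nu))$,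 $\gcd(\alpha,\omega)=1$, $0<\omega<\alpha$. The legs ending at $E_i$, $\widetilde E_j$ have invariants $(\alpha_i,\omega_i)$, $(\widetilde\alpha_j,\widetilde\omega_j)$. With $\det$ of a (sub)graph being the determinant of minus its intersection matrix ($\det\emptyset=1$): $\alpha_0=\det(\overline E_1,\dots,\overline E_s)$, $\omega_0=\det(\overline E_2,\dots,\overline E_s)$, $\widetilde\omega_0=\det(\overline E_1,\dots,\overline E_{s-1})$; the chain decorations are also $\le-2$. Put $$e=b_0+\frac{\omega_0}{\alpha_0}+\sum_i\frac{\omega_i}{\alpha_i},\quad \widetilde e=\widetilde b_0+\frac{\widetilde\omega_0}{\alpha_0}+\sum_j\frac{\widetilde\omega_j}{\widetilde\alpha_j},\quad \mathfrak I^{orb}=\begin{pmatrix}e&1/\alpha_0\\1/\alpha_0&\widetilde e\end{pmatrix}.$$ **Lattice and series.** $L$ is the free $\mathbb Z$-module on the vertices, with negative definite intersection form (decorations on the diagonal, $1$ for adjacent vertices, $0$ otherwise); $L'=\{l'\in L\otimes\mathbb Q:(l',L)\subseteq\mathbb Z\}$; $E_v^*\in L'$ with $(E_v^*,E_w)=-1$ if $v=w$ and $0$ otherwise; $H=L'/L$. $Z(\mathbf t)=\sum p_{l'}\mathbf t^{l'}$ is the Taylor expansion at the origin of $\prod_v(1-\mathbf t^{E_v^*})^{\delta_v-2}$ ($\delta_v$ = valency, $\mathbf t^{l'}=\prod_vt_v^{l'_v}$), $Z_h(\mathbf t)=\sum_{[l']=h}p_{l'}\mathbf t^{l'}$, and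 $Z_h(t,\widetilde t)$ is obtained from $Z_h(\mathbf t)$ by setting all variables equal to $1$ except $t$ (that of $E_0$) and $\widetilde t$ (that of $\widetilde E_0$). **Lifts.** A lift of $h$ is an integer vector $\mathbf c=(c_0,\widetilde c_0,\overline c,(c_i)_{i=1}^d,(\widetilde c_j)_{j=1}^{\widetilde d})$ such that $c_0E_0^*+\widetilde c_0\widetilde E_0^*+\overline c\,\overline E_1^*+\sum_ic_iE_i^*+\sum_j\widetilde c_j\widetilde E_j^*$ has class $h$. Its $E_0$- and $\widetilde E_0$-coefficients are $c,\widetilde c$: $$\begin{pmatrix}c\\\widetilde c\end{pmatrix}=(-\mathfrak I^{orb})^{-1}\begin{pmatrix}A\\\widetilde A\end{pmatrix},\quad A=c_0+\sum_i\frac{c_i}{\alpha_i}+\frac{\omega_0}{\alpha_0}\overline c,\quad\widetilde A=\widetilde c_0+\sum_j\frac{\widetilde c_j}{\widetilde\alpha_j}+\frac1{\alpha_0}\overline c.$$ Finally $$N_{\mathbf c}(\ell,\widetilde\ell)=c_0+\tfrac{\omega_0}{\alpha_0}\overline c-\big(b_0+\tfrac{\omega_0}{\alpha_0}\big)\ell-\tfrac1{\alpha_0}\widetilde\ell+\sum_i\Big\lfloor\frac{c_i-\omega_i\ell}{\alpha_i}\Big\rfloor,$$ $$\widetilde N_{\mathbf c}(\ell,\widetilde\ell)=\widetilde c_0+\tfrac1{\alpha_0}\overline c-\big(\widetilde b_0+\tfrac{\widetilde\omega_0}{\alpha_0}\big)\widetilde\ell-\tfrac1{\alpha_0}\ell+\sum_j\Big\lfloor\frac{\widetilde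 c_j-\widetilde\omega_j\widetilde\ell}{\widetilde\alpha_j}\Big\rfloor.$$ *)

theory Defs
  imports
    "HOL-Computational_Algebra.Formal_Power_Series"
    "HOL-Number_Theory.Cong"
    "Jordan_Normal_Form.Determinant"
    "Jordan_Normal_Form.Gauss_Jordan_Elimination"
begin

section \<open>Plumbing graphs and their lattices\<close>

text \<open>
  The vertex set of a graph is the whole finite type \<open>'v\<close>.  All genera are \<open>0\<close> and are
  not recorded.  Elements of \<open>L \<otimes> \<rat>\<close> are the functions \<open>'v \<Rightarrow> rat\<close> giving the
  coefficients with respect to the basis \<open>E_base v\<close>.
\<close>

record 'v plumbing_graph =
  edge :: "'v \<Rightarrow> 'v \<Rightarrow> bool"
  dec :: "'v \<Rightarrow> int"

definition valency :: "('v::finite, 'z) plumbing_graph_scheme \<Rightarrow> 'v \<Rightarrow> nat" where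
  "valency G v = card {w. edge G v w}"

definition is_path :: "('v::finite, 'z) plumbing_graph_scheme \<Rightarrow> 'v list \<Rightarrow> bool" where
  "is_path G xs \<longleftrightarrow> distinct xs \<and> successively (edge G) xs"

definition is_cycle :: "('v::finite, 'z) plumbing_graph_scheme \<Rightarrow> 'v list \<Rightarrow> bool" where
  "is_cycle G xs \<longleftrightarrow> is_path G xs \<and> length xs \<ge> 3 \<and> edge G (last xs) (hd xs)"

definition is_tree :: "('v::finite, 'z) plumbing_graph_scheme \<Rightarrow> bool" where
  "is_tree G \<longleftrightarrow> symp (edge G) \<and> irreflp (edge G)
     \<and> (\<forall>v w. (edge G)\<^sup>*\<^sup>* v w) \<and> (\<nexists>xs. is_cycle G xs)"

definition intersection_number :: "('v::finite, 'z) plumbing_graph_scheme \<Rightarrow> 'v \<Rightarrow> 'v \<Rightarrow> int" where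
  "intersection_number G v w = (if v = w then dec G v else if edge G v w then 1 else 0)"

definition form :: "('v::finite, 'z) plumbing_graph_scheme \<Rightarrow> ('v \<Rightarrow> rat) \<Rightarrow> ('v \<Rightarrow> rat) \<Rightarrow> rat" where
  "form G x y = (\<Sum>v\<in>UNIV. \<Sum>w\<in>UNIV. x v * y w * of_int (intersection_number G v w))"

definition E_base :: "'v \<Rightarrow> 'v \<Rightarrow> rat" where
  "E_base v = (\<lambda>w. if w = v then 1 else 0)"

definition int_lattice :: "('v \<Rightarrow> rat) set" where
  "int_lattice = {l. \<forall>v. l v \<in> \<int>}"

definition negative_definite :: "('v::finite, 'z) plumbing_graph_scheme \<Rightarrow> bool" where
  "negative_definite G \<longleftrightarrow> (\<forall>l\<in>int_lattice. l \<noteq> (\<lambda>_. 0) \<longrightarrow> form G l l < 0)"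

definition dual_lattice :: "('v::finite, 'z) plumbing_graph_scheme \<Rightarrow> ('v \<Rightarrow> rat) set" where
  "dual_lattice G = {l'. \<forall>l\<in>int_lattice. form G l' l \<in> \<int>}"

definition E_dual :: "('v::finite, 'z) plumbing_graph_scheme \<Rightarrow> 'v \<Rightarrow> 'v \<Rightarrow> rat" where
  "E_dual G v = (THE x. x \<in> dual_lattice G \<and> (\<forall>w. form G x (E_base w) = (if v = w then -1 else 0)))"

definition lattice_rel :: "('v::finite, 'z) plumbing_graph_scheme \<Rightarrow> (('v \<Rightarrow> rat) \<times> ('v \<Rightarrow> rat)) set" where
  "lattice_rel G = {(x, y). x \<in> dual_lattice G \<and> y \<in> dual_lattice G \<and> (\<lambda>v. x v - y v) \<in> int_lattice}"

definition discriminant_group :: "('v::finite, 'z) plumbing_graph_scheme \<Rightarrow> ('v \<Rightarrow> rat) set set" where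
  "discriminant_group G = dual_lattice G // lattice_rel G"

definition disc_class :: "('v::finite, 'z) plumbing_graph_scheme \<Rightarrow> ('v \<Rightarrow> rat) \<Rightarrow> ('v \<Rightarrow> rat) set" where
  "disc_class G l' = lattice_rel G `` {l'}"

text \<open>Determinant of minus the intersection matrix of the subgraph on the vertices in \<open>xs\<close>.\<close>

definition graph_det :: "('v::finite, 'z) plumbing_graph_scheme \<Rightarrow> 'v list \<Rightarrow> int" where
  "graph_det G xs =
     det (mat (length xs) (length xs) (\<lambda>(i, j). - intersection_number G (xs ! i) (xs ! j)))"


section \<open>The series \<open>Z\<close> and its reductions\<close>

text \<open>
  A series with rational exponents is given by its coefficient function.  The factor of \<open>v\<close> in
  the product is \<open>f (t^(E_dual v))\<close>, where \<open>f\<close> is the Taylor expansion at the origin of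
  \<open>(1 - X)^(valency v - 2)\<close>.  Hence the coefficient of \<open>t^l'\<close> in the product is the sum below
  over all \<open>n\<close> with \<open>(\<Sum>v. n v * E_dual v) = l'\<close>; there is at most one such \<open>n\<close> since the
  \<open>E_dual v\<close> are linearly independent.
\<close>

definition Z_coeff :: "('v::finite, 'z) plumbing_graph_scheme \<Rightarrow> ('v \<Rightarrow> rat) \<Rightarrow> rat" where
  "Z_coeff G l' =
     (\<Sum>n | (\<lambda>w. \<Sum>v\<in>UNIV. of_nat (n v) * E_dual G v w) = l'.
        \<Prod>v\<in>UNIV. fps_nth ((1 - fps_X :: rat fps) powi (int (valency G v) - 2)) (n v :: nat))"

definition Zh_coeff :: "('v::finite, 'z) plumbing_graph_scheme \<Rightarrow> ('v \<Rightarrow> rat) set \<Rightarrow> ('v \<Rightarrow> rat) \<Rightarrow> rat" where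
  "Zh_coeff G h l' = (if l' \<in> dual_lattice G \<and> disc_class G l' = h then Z_coeff G l' else 0)"

text \<open>
  Setting all variables except those of \<open>u\<close> and \<open>w\<close> equal to \<open>1\<close> adds up the coefficients of all
  monomials with the same exponents at \<open>u\<close> and \<open>w\<close>.  For a connected negative definite graph all
  entries of the \<open>E_dual v\<close> are positive, so only finitely many summands are nonzero.
\<close>

definition Zh_reduced ::
  "('v::finite, 'z) plumbing_graph_scheme \<Rightarrow> ('v \<Rightarrow> rat) set \<Rightarrow> 'v \<Rightarrow> 'v \<Rightarrow> rat \<times> rat \<Rightarrow> rat" where
  "Zh_reduced G h u w =
     (\<lambda>(a, b). \<Sum>l' | Zh_coeff G h l' \<noteq> 0 \<and> l' u = a \<and> l' w = b. Zh_coeff G h l')"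

text \<open>The two-variable series \<open>\<Sum>s\<in>S. t^(fst (\<epsilon> s)) * t'^(snd (\<epsilon> s))\<close>.\<close>

definition monomial_sum :: "'s set \<Rightarrow> ('s \<Rightarrow> rat \<times> rat) \<Rightarrow> rat \<times> rat \<Rightarrow> rat" where
  "monomial_sum S \<epsilon> = (\<lambda>p. of_nat (card {s \<in> S. \<epsilon> s = p}))"


section \<open>Graphs with two nodes\<close>

text \<open>
  Leg number \<open>i\<close> of the first (second) node, \<open>i = 1, \<dots>, d1\<close> (\<open>i = 1, \<dots>, d2\<close>), is the list of its
  vertices, starting with the one adjacent to the node.  The chain is listed from the first to the
  second node.  The suffixes 1 and 2 stand for the objects without and with a tilde.
\<close>

record 'v two_node_graph = "'v plumbing_graph" +
  node1 :: 'v
  node2 :: 'v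
  chain :: "'v list"
  d1 :: nat
  d2 :: nat
  leg1 :: "nat \<Rightarrow> 'v list"
  leg2 :: "nat \<Rightarrow> 'v list"

definition is_leg :: "('v::finite, 'z) plumbing_graph_scheme \<Rightarrow> 'v \<Rightarrow> 'v list \<Rightarrow> bool" where
  "is_leg G v xs \<longleftrightarrow> xs \<noteq> [] \<and> is_path G (v # xs)
     \<and> (\<forall>x\<in>set (butlast xs). valency G x = 2) \<and> valency G (last xs) = 1"

definition is_chain :: "('v::finite, 'z) plumbing_graph_scheme \<Rightarrow> 'v \<Rightarrow> 'v \<Rightarrow> 'v list \<Rightarrow> bool" where
  "is_chain G v w xs \<longleftrightarrow> xs \<noteq> [] \<and> is_path G (v # xs @ [w]) \<and> (\<forall>x\<in>set xs. valency G x = 2)"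

definition two_node_tree :: "('v::finite) two_node_graph \<Rightarrow> bool" where
  "two_node_tree G \<longleftrightarrow>
     is_tree G \<and> negative_definite G
     \<and> node1 G \<noteq> node2 G \<and> {v. valency G v \<ge> 3} = {node1 G, node2 G}
     \<and> is_chain G (node1 G) (node2 G) (chain G)
     \<and> d1 G \<ge> 2 \<and> bij_betw (leg1 G) {1..d1 G} {xs. is_leg G (node1 G) xs}
     \<and> d2 G \<ge> 2 \<and> bij_betw (leg2 G) {1..d2 G} {xs. is_leg G (node2 G) xs}
     \<and> (\<forall>i\<in>{1..d1 G}. \<forall>x\<in>set (leg1 G i). dec G x \<le> -2)
     \<and> (\<forall>j\<in>{1..d2 G}. \<forall>x\<in>set (leg2 G j). dec G x \<le> -2)
     \<and> (\<forall>x\<in>set (chain G). dec G x \<le> -2)"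

fun continued_fraction :: "int list \<Rightarrow> rat" where
  "continued_fraction [] = 0"
| "continued_fraction [b] = of_int b"
| "continued_fraction (b # b' # bs) = of_int b - 1 / continued_fraction (b' # bs)"

definition seifert_invariant :: "int list \<Rightarrow> int \<times> int" where
  "seifert_invariant bs = (THE (a, w). of_int a / of_int w = continued_fraction bs
     \<and> coprime a w \<and> 0 < w \<and> w < a)"

definition \<alpha>1 :: "('v::finite) two_node_graph \<Rightarrow> nat \<Rightarrow> int" where
  "\<alpha>1 G i = fst (seifert_invariant (map (\<lambda>x. - dec G x) (leg1 G i)))"

definition \<omega>1 :: "('v::finite) two_node_graph \<Rightarrow> nat \<Rightarrow> int" where
  "\<omega>1 G i = snd (seifert_invariant (map (\<lambda>x. - dec G x) (leg1 G i)))"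

definition \<alpha>2 :: "('v::finite) two_node_graph \<Rightarrow> nat \<Rightarrow> int" where
  "\<alpha>2 G j = fst (seifert_invariant (map (\<lambda>x. - dec G x) (leg2 G j)))"

definition \<omega>2 :: "('v::finite) two_node_graph \<Rightarrow> nat \<Rightarrow> int" where
  "\<omega>2 G j = snd (seifert_invariant (map (\<lambda>x. - dec G x) (leg2 G j)))"

definition \<alpha>\<^sub>0 :: "('v::finite) two_node_graph \<Rightarrow> int" where
  "\<alpha>\<^sub>0 G = graph_det G (chain G)"

definition \<omega>1\<^sub>0 :: "('v::finite) two_node_graph \<Rightarrow> int" where
  "\<omega>1\<^sub>0 G = graph_det G (tl (chain G))"

definition \<omega>2\<^sub>0 :: "('v::finite) two_node_graph \<Rightarrow> int" where
  "\<omega>2\<^sub>0 G = graph_det G (butlast (chain G))"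

definition e1 :: "('v::finite) two_node_graph \<Rightarrow> rat" where
  "e1 G = of_int (dec G (node1 G)) + of_int (\<omega>1\<^sub>0 G) / of_int (\<alpha>\<^sub>0 G)
     + (\<Sum>i=1..d1 G. of_int (\<omega>1 G i) / of_int (\<alpha>1 G i))"

definition e2 :: "('v::finite) two_node_graph \<Rightarrow> rat" where
  "e2 G = of_int (dec G (node2 G)) + of_int (\<omega>2\<^sub>0 G) / of_int (\<alpha>\<^sub>0 G)
     + (\<Sum>j=1..d2 G. of_int (\<omega>2 G j) / of_int (\<alpha>2 G j))"

definition I_orb :: "('v::finite) two_node_graph \<Rightarrow> rat mat" where
  "I_orb G = mat_of_rows_list 2
     [[e1 G, 1 / of_int (\<alpha>\<^sub>0 G)],
      [1 / of_int (\<alpha>\<^sub>0 G), e2 G]]"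


section \<open>Lifts\<close>

text \<open>
  In the notation of the mathematics, the components are \<open>c\<^sub>0\<close>, \<open>c\<^sub>0\<close> with a tilde, \<open>c\<close> with a
  bar, \<open>c\<^sub>i\<close> for \<open>i = 1, \<dots>, d1\<close> and \<open>c\<^sub>j\<close> with a tilde for \<open>j = 1, \<dots>, d2\<close>; the values of the last
  two at other indices are never used.
\<close>

record lift_vector =
  c1\<^sub>0 :: int
  c2\<^sub>0 :: int
  cbar :: int
  c1 :: "nat \<Rightarrow> int"
  c2 :: "nat \<Rightarrow> int"

definition lift_element :: "('v::finite) two_node_graph \<Rightarrow> lift_vector \<Rightarrow> 'v \<Rightarrow> rat" where
  "lift_element G c = (\<lambda>v.
     of_int (c1\<^sub>0 c) * E_dual G (node1 G) v + of_int (c2\<^sub>0 c) * E_dual G (node2 G) v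
     + of_int (cbar c) * E_dual G (hd (chain G)) v
     + (\<Sum>i=1..d1 G. of_int (c1 c i) * E_dual G (last (leg1 G i)) v)
     + (\<Sum>j=1..d2 G. of_int (c2 c j) * E_dual G (last (leg2 G j)) v))"

definition is_lift :: "('v::finite) two_node_graph \<Rightarrow> ('v \<Rightarrow> rat) set \<Rightarrow> lift_vector \<Rightarrow> bool" where
  "is_lift G h c \<longleftrightarrow> disc_class G (lift_element G c) = h"

definition A1 :: "('v::finite) two_node_graph \<Rightarrow> lift_vector \<Rightarrow> rat" where
  "A1 G c = of_int (c1\<^sub>0 c) + (\<Sum>i=1..d1 G. of_int (c1 c i) / of_int (\<alpha>1 G i))
     + of_int (\<omega>1\<^sub>0 G) / of_int (\<alpha>\<^sub>0 G) * of_int (cbar c)"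

definition A2 :: "('v::finite) two_node_graph \<Rightarrow> lift_vector \<Rightarrow> rat" where
  "A2 G c = of_int (c2\<^sub>0 c) + (\<Sum>j=1..d2 G. of_int (c2 c j) / of_int (\<alpha>2 G j))
     + 1 / of_int (\<alpha>\<^sub>0 G) * of_int (cbar c)"

text \<open>
  The column vector of the coefficients of \<open>lift_element G c\<close> at the two nodes, by the explicit
  formula.
\<close>

definition node_coeffs :: "('v::finite) two_node_graph \<Rightarrow> lift_vector \<Rightarrow> rat vec" where
  "node_coeffs G c = the (mat_inverse (- I_orb G)) *\<^sub>v vec_of_list [A1 G c, A2 G c]"

definition N1 :: "('v::finite) two_node_graph \<Rightarrow> lift_vector \<Rightarrow> int \<Rightarrow> int \<Rightarrow> rat" where
  "N1 G c l1 l2 =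
     of_int (c1\<^sub>0 c) + of_int (\<omega>1\<^sub>0 G) / of_int (\<alpha>\<^sub>0 G) * of_int (cbar c)
     - (of_int (dec G (node1 G)) + of_int (\<omega>1\<^sub>0 G) / of_int (\<alpha>\<^sub>0 G)) * of_int l1
     - 1 / of_int (\<alpha>\<^sub>0 G) * of_int l2
     + (\<Sum>i=1..d1 G. of_int \<lfloor>of_int (c1 c i - \<omega>1 G i * l1) / of_int (\<alpha>1 G i) :: rat\<rfloor>)"

definition N2 :: "('v::finite) two_node_graph \<Rightarrow> lift_vector \<Rightarrow> int \<Rightarrow> int \<Rightarrow> rat" where
  "N2 G c l1 l2 =
     of_int (c2\<^sub>0 c) + 1 / of_int (\<alpha>\<^sub>0 G) * of_int (cbar c)
     - (of_int (dec G (node2 G)) + of_int (\<omega>2\<^sub>0 G) / of_int (\<alpha>\<^sub>0 G)) * of_int l2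
     - 1 / of_int (\<alpha>\<^sub>0 G) * of_int l1
     + (\<Sum>j=1..d2 G. of_int \<lfloor>of_int (c2 c j - \<omega>2 G j * l2) / of_int (\<alpha>2 G j) :: rat\<rfloor>)"

definition lift_support :: "('v::finite) two_node_graph \<Rightarrow> lift_vector \<Rightarrow> (int \<times> int) set" where
  "lift_support G c = {(l1, l2). N1 G c l1 l2 \<ge> 0 \<and> N2 G c l1 l2 \<ge> 0
     \<and> [l1 + \<omega>2\<^sub>0 G * l2 = cbar c] (mod \<alpha>\<^sub>0 G)}"

end

theory Submission
  imports "HOL-Analysis.Cartesian_Space" Defs
begin

text \<open>
  Fix a lift \<open>c\<close> of \<open>h\<close> and let \<open>r = lift_element G c\<close>.  A monomial of \<open>Z\<close> in the class \<open>h\<close> has an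
  exponent \<open>l' = (\<Sum>v. n v * E_dual v)\<close> with natural numbers \<open>n v\<close>, and \<open>x = l' - r\<close> is an integral
  vector.  Vertices of valency 2 contribute the factor 1 to \<open>Z\<close>, so there \<open>n v = 0\<close>; the
  end-vertices contribute \<open>1 / (1 - X)\<close>, whose coefficients are all 1; the two nodes contribute
  \<open>(1 - X) ^ (d - 1)\<close>, where \<open>d\<close> is the number of legs.

  Pairing \<open>x\<close> with the basis vectors along a leg or along the chain gives a three-term recurrence
  for the coordinates of \<open>x\<close> there (\<open>leg_relation\<close>, \<open>chain_relation\<close>), which is solved by continuants,
  i.e. by the numbers in the Seifert invariants and by the determinants of subchains.  Hence,
  writing \<open>(l1, l2)\<close> for the coordinates of \<open>x\<close> at the nodes, \<open>x\<close> is integral iff \<open>l1\<close>, \<open>l2\<close> are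
  integers and
    \<^item> on each leg, \<open>n\<close> at its end is congruent to \<open>c - \<omega> * l\<close> modulo \<open>\<alpha>\<close> (with \<open>l\<close> the coordinate at
      the node of the leg and \<open>c\<close> the component of the lift at that end), and
    \<^item> on the chain, the congruence modulo \<open>\<alpha>\<^sub>0\<close> from the definition of the support holds
  (\<open>int_lattice_iff\<close>).  The remaining two equations, at the nodes, become
  \<open>n v + (\<Sum>i. z i) = N\<close>, where \<open>v\<close> is the node, \<open>z i\<close> is the quotient of \<open>n\<close> at the end of leg \<open>i\<close>
  by \<open>\<alpha> i\<close>, and \<open>N\<close> is the number \<open>N1\<close> or \<open>N2\<close> (\<open>exponents_iff\<close>, \<open>residue_sum\<close>).

  So for fixed \<open>(l1, l2)\<close> the coefficient is a product of two sums, one for each node.  The sum over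
  all natural numbers \<open>n v\<close>, \<open>z 1\<close>, \<dots>, \<open>z d\<close> with total \<open>N\<close> of the coefficient of \<open>X ^ (n v)\<close> in
  \<open>(1 - X) ^ (d - 1)\<close> is the coefficient of \<open>X ^ N\<close> in
  \<open>(1 - X) ^ (d - 1) * (1 - X) ^ (- d) = 1 / (1 - X)\<close>, which is 1 for \<open>N \<ge> 0\<close> and 0 otherwise.

  Two auxiliary facts carry the argument.  The tree consists of the nodes, the chain and the legs
  only (\<open>vertex_cases\<close>), so that these recurrences control all coordinates.  And the orbifold matrix is
  invertible (\<open>orb_det_nonzero\<close>), so that the node equations determine the node coordinates and
  \<open>node_coeffs G c\<close> consists of the node coordinates of \<open>r\<close> (\<open>node_coeffs_eq\<close>).
\<close>

(* The infix $ is declared twice; below it is the entry of a vector of arbitrary dimension. *)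
unbundle no vec_syntax

section \<open>Paths in trees\<close>

lemma path_edge_nth:
  "is_path G ps \<Longrightarrow> Suc k < length ps \<Longrightarrow> edge G (ps ! k) (ps ! Suc k)"
  by (simp add: is_path_def successively_nth)

lemma path_rev: "symp (edge G) \<Longrightarrow> is_path G xs \<Longrightarrow> is_path G (rev xs)"
  unfolding is_path_def by (auto elim: successively_mono dest: sympD)

text \<open>Paths that start along different edges never meet again: the first vertex of \<open>xs\<close> that lies on \<open>ys\<close> would otherwise
close up a cycle through \<open>v\<close>.\<close>

lemma path_heads:
  assumes tree: "is_tree G" and xs: "is_path G (v # xs)" and ys: "is_path G (v # ys)"
    and meet: "set xs \<inter> set ys \<noteq> {}"
  shows "hd xs = hd ys"
proof (rule ccontr)
  assume ne: "hd xs \<noteq> hd ys"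
  have sym: "symp (edge G)" using tree by (simp add: is_tree_def)
  have "\<exists>x\<in>set xs. x \<in> set ys" using meet by auto
  then obtain as z bs where xs_eq: "xs = as @ z # bs" and z: "z \<in> set ys"
    and as: "\<forall>x\<in>set as. x \<notin> set ys"
    using split_list_first_prop[of xs "\<lambda>x. x \<in> set ys"] by blast
  obtain cs ds where ys_eq: "ys = cs @ z # ds" using z by (meson split_list)
  let ?C = "v # as @ z # rev cs"
  have "as \<noteq> [] \<or> cs \<noteq> []" using ne xs_eq ys_eq by auto
  then have len: "length ?C \<ge> 3" by (cases as; cases cs) auto
  have "successively (edge G) (cs @ [z])" "successively (edge G) ((v # as) @ [z])"
    using xs ys unfolding xs_eq ys_eq is_path_def
    by (auto simp: successively_Cons successively_append_iff hd_append)
  moreover from this(1) have "successively (edge G) (z # rev cs)"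
    using successively_rev[of "edge G" "cs @ [z]"] sym
    by (auto elim!: successively_mono dest: sympD)
  ultimately have suc: "successively (edge G) ?C"
    using successively_append_iff[of "edge G" "v # as" "[z]"]
      successively_append_iff[of "edge G" "v # as" "z # rev cs"] by simp
  have dist: "distinct ?C"
    using xs ys as unfolding xs_eq ys_eq is_path_def by auto
  have "edge G v (hd ys)" using ys ys_eq unfolding is_path_def successively_Cons by auto
  then have "edge G (hd ys) v" using sym by (simp add: sympD)
  moreover have "last ?C = hd ys" unfolding ys_eq by (cases cs) auto
  ultimately have "is_cycle G ?C" using suc dist len unfolding is_cycle_def is_path_def by simp
  then show False using tree by (auto simp: is_tree_def)
qed

lemma valency_eq_2_neighbours:
  assumes "valency G v = 2" "edge G v a" "edge G v b" "a \<noteq> b"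
  shows "{w. edge G v w} = {a, b}"
proof (rule sym, rule card_subset_eq)
  show "card {a, b} = card {w. edge G v w}" using assms unfolding valency_def by simp
qed (use assms in auto)

lemma valency_eq_1_neighbours:
  assumes "valency G v = 1" "edge G v a"
  shows "{w. edge G v w} = {a}"
proof (rule sym, rule card_subset_eq)
  show "card {a} = card {w. edge G v w}" using assms unfolding valency_def by simp
qed (use assms in auto)

lemma path_neighbours:
  assumes "symp (edge G)" "is_path G ps" "Suc (Suc k) < length ps"
  shows "edge G (ps ! Suc k) (ps ! k)" "edge G (ps ! Suc k) (ps ! Suc (Suc k))"
    "ps ! k \<noteq> ps ! Suc (Suc k)"
proof -
  show "edge G (ps ! Suc k) (ps ! k)"
    using path_edge_nth[OF assms(2), of k] assms sympD by fastforce
  show "edge G (ps ! Suc k) (ps ! Suc (Suc k))"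
    using path_edge_nth[OF assms(2)] assms by auto
  show "ps ! k \<noteq> ps ! Suc (Suc k)"
    using assms by (auto simp: is_path_def nth_eq_iff_index_eq)
qed

lemma path_inner_valency_ge_2:
  assumes "symp (edge G)" "is_path G ps" "Suc (Suc k) < length ps"
  shows "valency G (ps ! Suc k) \<ge> 2"
proof -
  have "card {ps ! k, ps ! Suc (Suc k)} \<le> card {w. edge G (ps ! Suc k) w}"
    by (rule card_mono) (use path_neighbours[OF assms] in auto)
  then show ?thesis using path_neighbours[OF assms] by (simp add: valency_def)
qed

lemma path_inner_neighbours:
  assumes "symp (edge G)" "is_path G ps" "Suc (Suc k) < length ps" "valency G (ps ! Suc k) = 2"
  shows "{w. edge G (ps ! Suc k) w} = {ps ! k, ps ! Suc (Suc k)}"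
  using path_neighbours[OF assms(1-3)] valency_eq_2_neighbours[OF assms(4)] by blast

lemma path_last_neighbours:
  assumes "symp (edge G)" "is_path G (v # xs)" "xs \<noteq> []" "valency G (last xs) = 1"
  shows "{w. edge G (last xs) w} = {(v # xs) ! (length xs - 1)}"
proof -
  obtain k where k: "length xs = Suc k" using assms(3) by (cases xs) auto
  have "edge G ((v # xs) ! k) (last xs)"
    using path_edge_nth[OF assms(2), of k] k assms(3) by (simp add: last_conv_nth)
  then show ?thesis
    using valency_eq_1_neighbours[OF assms(4)] assms(1) k by (auto dest: sympD)
qed

text \<open>A walk through vertices of valency 2 has no choice: at each of them the next vertex is the neighbour
that the walk did not come from.  So the first two vertices determine the walk up to its first vertex of
another valency.  This separates legs with different heads and legs from the chain.\<close>

lemma path_determined: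
  assumes "symp (edge G)"
  shows "is_path G (u # v # xs) \<Longrightarrow> is_path G (u # v # ys)
    \<Longrightarrow> \<forall>x\<in>set (butlast (v # xs)). valency G x = 2 \<Longrightarrow> \<forall>x\<in>set (butlast (v # ys)). valency G x = 2
    \<Longrightarrow> valency G (last (v # xs)) \<noteq> 2 \<Longrightarrow> valency G (last (v # ys)) \<noteq> 2 \<Longrightarrow> xs = ys"
proof (induction xs arbitrary: u v ys)
  case Nil
  then show ?case by (cases ys) auto
next
  case (Cons x xs)
  then have val: "valency G v = 2" by simp
  then obtain y ys' where ys: "ys = y # ys'" using Cons.prems by (cases ys) auto
  have "{w. edge G v w} = {u, x}"
    using path_inner_neighbours[OF assms Cons.prems(1), of 0] val by simp
  moreover have "{w. edge G v w} = {u, y}"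
    using path_inner_neighbours[OF assms Cons.prems(2), of 0] val ys by simp
  moreover have "u \<noteq> x" "u \<noteq> y" using Cons.prems ys by (auto simp: is_path_def)
  ultimately have xy: "x = y" by (metis doubleton_eq_iff)
  have "xs = ys'"
    by (rule Cons.IH[of v x]) (use Cons.prems ys xy in \<open>auto simp: is_path_def\<close>)
  then show ?case using ys xy by simp
qed

section \<open>The shape of a tree with two nodes\<close>

text \<open>The two nodes play symmetric roles: every fact of this locale holds with \<open>v\<close> and \<open>w\<close> exchanged and
the chain reversed (\<open>swap\<close> below).\<close>

locale two_nodes =
  fixes G :: "('v::finite, 'z) plumbing_graph_scheme" and v w :: 'v and ch :: "'v list"
  assumes tree: "is_tree G" and nodes_ne: "v \<noteq> w" and nodes: "{x. valency G x \<ge> 3} = {v, w}"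
    and chain: "is_chain G v w ch"
begin

lemma edge_symp: "symp (edge G)" using tree by (simp add: is_tree_def)

lemma no_loop: "\<not> edge G x x" using tree by (auto simp: is_tree_def irreflp_def)

lemma not_node: "x \<noteq> v \<Longrightarrow> x \<noteq> w \<Longrightarrow> valency G x \<le> 2"
  using nodes by (metis (mono_tags, lifting) insertE mem_Collect_eq not_less_eq_eq numeral_2_eq_2 numeral_3_eq_3 singletonD)

lemma node_valency: "valency G v \<ge> 3" "valency G w \<ge> 3" using nodes by auto

lemma swap: "two_nodes G w v (rev ch)"
proof
  show "is_chain G w v (rev ch)"
    using chain path_rev[OF edge_symp, of "v # ch @ [w]"] by (auto simp: is_chain_def)
qed (use tree nodes_ne nodes in auto)

lemma chain_nonempty: "ch \<noteq> []" and chain_path: "is_path G (v # ch @ [w])"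
  and chain_valency: "x \<in> set ch \<Longrightarrow> valency G x = 2"
  using chain by (auto simp: is_chain_def)

lemma legD:
  assumes "is_leg G v xs"
  shows "xs \<noteq> []" "is_path G (v # xs)" "x \<in> set (butlast xs) \<Longrightarrow> valency G x = 2"
    "valency G (last xs) = 1"
  using assms by (auto simp: is_leg_def)

lemma leg_valency:
  assumes "is_leg G v xs" "x \<in> set xs"
  shows "valency G x = 1 \<or> valency G x = 2"
proof -
  have "set (butlast xs @ [last xs]) = set xs"
    by (simp only: append_butlast_last_id[OF legD(1)[OF assms(1)]])
  then have "set xs = insert (last xs) (set (butlast xs))" by simp
  then show ?thesis using legD(3,4)[OF assms(1)] assms(2) by auto
qed

lemma leg_avoids_nodes:
  assumes "is_leg G v xs"
  shows "v \<notin> set xs" "w \<notin> set xs"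
  using leg_valency[OF assms, of v] leg_valency[OF assms, of w] node_valency by auto

lemma leg_eq:
  assumes xs: "is_leg G v xs" and ys: "is_leg G v ys" and meet: "set xs \<inter> set ys \<noteq> {}"
  shows "xs = ys"
proof -
  have hd: "hd xs = hd ys" by (rule path_heads[OF tree legD(2)[OF xs] legD(2)[OF ys] meet])
  have "xs = hd ys # tl xs" "ys = hd ys # tl ys"
    using legD(1)[OF xs] legD(1)[OF ys] hd by (metis hd_Cons_tl, simp)
  moreover from this have "tl xs = tl ys"
    using path_determined[OF edge_symp, of v "hd ys" "tl xs" "tl ys"] xs ys unfolding is_leg_def by auto
  ultimately show ?thesis by simp
qed

text \<open>With a common head the leg and the chain extended by \<open>w\<close> would be the same walk, but one ends at a
vertex of valency 1 and the other at a node.\<close>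

lemma leg_head_not_chain:
  assumes "is_leg G v xs"
  shows "hd xs \<noteq> hd ch"
proof
  assume hd: "hd xs = hd ch"
  have xs: "xs = hd ch # tl xs" and ch: "ch = hd ch # tl ch"
    using legD(1)[OF assms] chain_nonempty hd by (metis hd_Cons_tl, simp)
  have bl: "butlast (hd ch # tl ch @ [w]) = ch"
    using ch by (metis append_Cons butlast_snoc)
  have "tl xs = tl ch @ [w]"
  proof (rule path_determined[OF edge_symp, of v "hd ch"])
    show "is_path G (v # hd ch # tl xs)" using legD(2)[OF assms] xs by simp
    show "is_path G (v # hd ch # tl ch @ [w])" using chain_path ch by (metis append_Cons)
    show "\<forall>x\<in>set (butlast (hd ch # tl xs)). valency G x = 2"
      using legD(3)[OF assms] xs by simp
    show "\<forall>x\<in>set (butlast (hd ch # tl ch @ [w])). valency G x = 2"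
      unfolding bl using chain_valency by simp
    show "valency G (last (hd ch # tl xs)) \<noteq> 2" using legD(4)[OF assms] xs by simp
    show "valency G (last (hd ch # tl ch @ [w])) \<noteq> 2" using node_valency(2) by simp
  qed
  then have "w \<in> set (hd ch # tl xs)" by simp
  then have "w \<in> set xs" using xs by simp
  then show False using leg_avoids_nodes[OF assms] by simp
qed

lemma leg_disjoint_chain:
  assumes "is_leg G v xs"
  shows "set xs \<inter> set (ch @ [w]) = {}"
proof (rule ccontr)
  assume "\<not> ?thesis"
  then have "hd xs = hd (ch @ [w])"
    using path_heads[OF tree legD(2)[OF assms] chain_path] by simp
  then show False using leg_head_not_chain[OF assms] chain_nonempty by simp
qed

text \<open>A leg of \<open>w\<close> prolongs the chain to a path from \<open>v\<close>; if it met a leg of \<open>v\<close>, that leg would start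
like the chain.\<close>

lemma legs_of_both_nodes_disjoint:
  assumes xs: "is_leg G v xs" and ys: "is_leg G w ys"
  shows "set xs \<inter> set ys = {}"
proof (rule ccontr)
  assume meet: "\<not> ?thesis"
  interpret r: two_nodes G w v "rev ch" by (rule swap)
  have "set ys \<inter> (set ch \<union> {v}) = {}" using r.leg_disjoint_chain[OF ys] by auto
  moreover have "w \<notin> set ys" using r.leg_avoids_nodes[OF ys] by simp
  ultimately have "distinct ((v # ch @ [w]) @ ys)"
    using chain_path r.legD(2)[OF ys] by (auto simp: is_path_def)
  moreover have "successively (edge G) ((v # ch) @ (w # ys))"
    using chain_path r.legD(2)[OF ys] successively_append_iff[of "edge G" "v # ch" "[w]"]
      successively_append_iff[of "edge G" "v # ch" "w # ys"] by (simp add: is_path_def)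
  ultimately have "is_path G (v # ch @ w # ys)" by (simp add: is_path_def)
  from path_heads[OF tree legD(2)[OF xs] this] meet
  have "hd xs = hd ch" using chain_nonempty by auto
  then show False using leg_head_not_chain[OF xs] by simp
qed

lemma valency_pos: "valency G x \<ge> 1"
proof -
  obtain y where "y \<noteq> x" using nodes_ne by metis
  moreover have "(edge G)\<^sup>*\<^sup>* x y" using tree by (simp add: is_tree_def)
  ultimately obtain z where "edge G x z" by (metis converse_rtranclpE)
  then have "valency G x \<noteq> 0" by (auto simp: valency_def)
  then show ?thesis by simp
qed

text \<open>Take a longest path from \<open>v\<close> through \<open>u\<close> that meets no further node.  If its last vertex had valency
2, its other neighbour would close a cycle, prolong the path, or be the node \<open>w\<close>; in the last case
the path to \<open>w\<close> would have to start like the chain.\<close>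

lemma leg_exists:
  assumes vu: "edge G v u" and u: "u \<noteq> hd ch"
  obtains xs where "is_leg G v xs" "hd xs = u"
proof -
  have no_w: False if "is_path G (v # xs @ [w])" "hd (xs @ [w]) = u" for xs
    using path_heads[OF tree that(1) chain_path] u that(2) chain_nonempty by simp
  define P where "P xs \<longleftrightarrow>
    xs \<noteq> [] \<and> hd xs = u \<and> is_path G (v # xs) \<and> (\<forall>x\<in>set xs. valency G x \<le> 2)" for xs
  have uv: "u \<noteq> v" using vu no_loop by auto
  moreover have "u \<noteq> w" using no_w[of "[]"] vu nodes_ne by (auto simp: is_path_def)
  ultimately have "P [u]" using vu not_node by (auto simp: P_def is_path_def)
  moreover have "length xs \<le> CARD('v)" if "P xs" for xs
  proof -
    have "distinct xs" using that by (auto simp: P_def is_path_def)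
    then show ?thesis using card_mono[of UNIV "set xs"] distinct_card[of xs] by simp
  qed
  ultimately have "P [u]" "\<forall>xs. P xs \<longrightarrow> length xs < Suc CARD('v)" by (auto simp: less_Suc_eq_le)
  then obtain xs where Pxs: "P xs" and max: "\<And>ys. P ys \<Longrightarrow> length ys \<le> length xs"
    using ex_has_greatest_nat[of P "[u]" length "Suc CARD('v)"] by blast
  then have xs: "xs \<noteq> []" "hd xs = u" "is_path G (v # xs)" "\<forall>x\<in>set xs. valency G x \<le> 2"
    by (auto simp: P_def)
  obtain k where k: "length xs = Suc k" using xs by (cases xs) auto
  let ?p = "(v # xs) ! k" let ?l = "last xs"
  have l: "?l = (v # xs) ! Suc k" using k xs by (simp add: last_conv_nth)
  have pl: "edge G ?p ?l" unfolding l using path_edge_nth[of G "v # xs" k] xs k by auto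
  have inner: "valency G x = 2" if x: "x \<in> set (butlast xs)" for x
  proof -
    obtain j where "j < length (butlast xs)" "x = butlast xs ! j"
      using x by (auto simp: in_set_conv_nth simp del: length_butlast)
    then have j: "j < k" "x = (v # xs) ! Suc j" using k by (auto simp: nth_butlast)
    then have "valency G x \<ge> 2" using path_inner_valency_ge_2[OF edge_symp, of "v # xs" j] xs k by auto
    moreover have "x \<in> set xs" using x by (rule in_set_butlastD)
    ultimately show ?thesis using xs by fastforce
  qed
  have "valency G ?l \<le> 2" using xs by auto
  moreover have "valency G ?l \<noteq> 2"
  proof
    assume v2: "valency G ?l = 2"
    have "\<exists>z. edge G ?l z \<and> z \<noteq> ?p"
    proof (rule ccontr)
      assume "\<not> ?thesis"
      then have "{z. edge G ?l z} \<subseteq> {?p}" by auto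
      then have "card {z. edge G ?l z} \<le> card {?p}" by (intro card_mono) auto
      then show False using v2 by (simp add: valency_def)
    qed
    then obtain z where z: "edge G ?l z" "z \<noteq> ?p" by blast
    have zl: "z \<noteq> ?l" using z no_loop by auto
    have z_new: "z \<notin> set (v # xs)"
    proof
      assume "z \<in> set (v # xs)"
      then obtain i where i: "i < length (v # xs)" "z = (v # xs) ! i"
        by (metis in_set_conv_nth)
      \<comment> \<open>The part of the path from \<open>z\<close> on closes up along the edge from \<open>?l\<close> to \<open>z\<close>; it has at least
        three vertices because \<open>z\<close> is neither \<open>?l\<close> nor its predecessor \<open>?p\<close>.\<close>
      let ?C = "drop i (v # xs)"
      have "i \<noteq> k" "i \<noteq> Suc k" using z zl i l by auto
      then have "length ?C \<ge> 3" using i k by auto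
      moreover have "is_path G ?C" using xs successively_append_iff[of "edge G" "take i (v # xs)" ?C]
        by (auto simp: is_path_def simp del: drop_Cons')
      moreover have "hd ?C = z" "last ?C = ?l" using i xs by (auto simp: hd_drop_conv_nth last_drop)
      ultimately have "is_cycle G ?C" using z by (simp add: is_cycle_def)
      then show False using tree by (auto simp: is_tree_def)
    qed
    have path: "is_path G (v # xs @ [z])"
    proof -
      have "successively (edge G) ((v # xs) @ [z])"
        using xs z(1) unfolding successively_append_iff is_path_def by auto
      then show ?thesis using xs z_new by (auto simp: is_path_def)
    qed
    have "z \<noteq> w" using no_w[of xs] path xs by auto
    then have "valency G z \<le> 2" using not_node[of z] z_new by auto
    then have "P (xs @ [z])" using path xs by (auto simp: P_def)
    from max[OF this] show False by simp
  qed
  ultimately have "valency G ?l = 1" using valency_pos[of ?l] by linarith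
  then have "is_leg G v xs" using xs inner by (auto simp: is_leg_def)
  then show ?thesis using that xs by blast
qed

lemma node_neighbours: "{u. edge G v u} = insert (hd ch) (hd ` {xs. is_leg G v xs})"
proof -
  have first: "edge G v (hd xs)" if "is_path G (v # xs)" "xs \<noteq> []" for xs
    using that by (cases xs) (auto simp: is_path_def)
  from first[OF chain_path] first[OF legD(2) legD(1)]
  have "edge G v (hd ch)" "\<And>xs. is_leg G v xs \<Longrightarrow> edge G v (hd xs)"
    using chain_nonempty by auto
  moreover have "u \<in> insert (hd ch) (hd ` {xs. is_leg G v xs})" if "edge G v u" for u
  proof (cases "u = hd ch")
    case False
    obtain xs where "is_leg G v xs" "hd xs = u"
      by (rule leg_exists[OF \<open>edge G v u\<close> False])
    then show ?thesis by blast
  qed simp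
  ultimately show ?thesis by auto
qed

lemma leg_inner_neighbours:
  assumes "is_leg G v xs" "Suc k < length xs"
  shows "{u. edge G (xs ! k) u} = {(v # xs) ! k, xs ! Suc k}" "(v # xs) ! k \<noteq> xs ! Suc k"
proof -
  have "xs ! k \<in> set (butlast xs)" using assms(2)
    by (metis One_nat_def Suc_lessE diff_Suc_1 length_butlast less_Suc_eq nth_butlast nth_mem Suc_less_eq)
  then have "valency G (xs ! k) = 2" using legD(3)[OF assms(1)] by simp
  then show "{u. edge G (xs ! k) u} = {(v # xs) ! k, xs ! Suc k}" "(v # xs) ! k \<noteq> xs ! Suc k"
    using path_inner_neighbours[OF edge_symp legD(2)[OF assms(1)], of k]
      path_neighbours(3)[OF edge_symp legD(2)[OF assms(1)], of k] assms(2) by auto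
qed

lemma leg_last_neighbours:
  assumes "is_leg G v xs"
  shows "{u. edge G (last xs) u} = {(v # xs) ! (length xs - 1)}"
  using path_last_neighbours[OF edge_symp] legD[OF assms] by blast

lemma chain_neighbours:
  assumes "k < length ch"
  shows "{u. edge G (ch ! k) u} = {(v # ch) ! k, (ch @ [w]) ! Suc k}"
    "(v # ch) ! k \<noteq> (ch @ [w]) ! Suc k"
proof -
  have *: "(v # ch @ [w]) ! k = (v # ch) ! k" "(v # ch @ [w]) ! Suc k = ch ! k"
    using assms by (auto simp: nth_append nth_Cons split: nat.split)
  have "valency G (ch ! k) = 2" using chain_valency assms by simp
  then show "{u. edge G (ch ! k) u} = {(v # ch) ! k, (ch @ [w]) ! Suc k}"
    "(v # ch) ! k \<noteq> (ch @ [w]) ! Suc k"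
    using path_inner_neighbours[OF edge_symp chain_path, of k]
      path_neighbours(3)[OF edge_symp chain_path, of k] assms * by auto
qed

lemma leg_neighbours_covered:
  assumes "is_leg G v xs" "x \<in> set xs" "edge G x y"
  shows "y \<in> insert v (set xs)"
proof -
  obtain k where k: "k < length xs" "x = xs ! k" using assms(2) by (auto simp: in_set_conv_nth)
  show ?thesis
  proof (cases "Suc k < length xs")
    case True
    then have "y \<in> {(v # xs) ! k, xs ! Suc k}"
      using leg_inner_neighbours[OF assms(1) True] assms(3) k by auto
    then show ?thesis using True by (auto simp: nth_Cons split: nat.splits)
  next
    case False
    then have k': "k = length xs - 1" using k by simp
    then have "x = last xs" using k legD(1)[OF assms(1)] by (simp add: last_conv_nth)
    then have "y = (v # xs) ! k" using leg_last_neighbours[OF assms(1)] assms(3) k' by auto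
    then show ?thesis using k by (auto simp: nth_Cons split: nat.splits)
  qed
qed

text \<open>The listed vertices include \<open>v\<close> and are closed under taking neighbours, and the graph is connected.\<close>

lemma vertex_cases:
  obtains "x = v" | "x = w" | "x \<in> set ch" | xs where "is_leg G v xs" "x \<in> set xs"
    | xs where "is_leg G w xs" "x \<in> set xs"
proof -
  interpret r: two_nodes G w v "rev ch" by (rule swap)
  let ?C = "{v, w} \<union> set ch \<union> \<Union>(set ` {xs. is_leg G v xs}) \<union> \<Union>(set ` {xs. is_leg G w xs})"
  have closed: "y \<in> ?C" if x: "x \<in> ?C" and e: "edge G x y" for x y
  proof -
    consider "x = v" | "x = w" | "x \<in> set ch" | xs where "is_leg G v xs" "x \<in> set xs"
      | xs where "is_leg G w xs" "x \<in> set xs" using x by auto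
    then show ?thesis
    proof cases
      case 1
      then have "y \<in> insert (hd ch) (hd ` {xs. is_leg G v xs})" using e node_neighbours by auto
      moreover have "hd ch \<in> set ch" "\<And>xs. is_leg G v xs \<Longrightarrow> hd xs \<in> set xs"
        using chain_nonempty legD(1) by auto
      ultimately show ?thesis by auto
    next
      case 2
      then have "y \<in> insert (hd (rev ch)) (hd ` {xs. is_leg G w xs})" using e r.node_neighbours by auto
      moreover have "hd (rev ch) \<in> set ch" "\<And>xs. is_leg G w xs \<Longrightarrow> hd xs \<in> set xs"
        using r.chain_nonempty r.legD(1) hd_in_set[of "rev ch"] by auto
      ultimately show ?thesis by auto
    next
      case 3
      then obtain k where "k < length ch" "x = ch ! k" by (auto simp: in_set_conv_nth)
      then have "y \<in> {(v # ch) ! k, (ch @ [w]) ! Suc k}" using chain_neighbours e by auto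
      moreover have "(v # ch) ! k \<in> set (v # ch)" "(ch @ [w]) ! Suc k \<in> set (ch @ [w])"
        using \<open>k < length ch\<close> by (auto intro!: nth_mem simp del: set_append list.set)
      ultimately show ?thesis by auto
    next
      case 4
      then show ?thesis using leg_neighbours_covered[OF 4 e] by auto
    next
      case 5
      then show ?thesis using r.leg_neighbours_covered[OF 5 e] by auto
    qed
  qed
  have "(edge G)\<^sup>*\<^sup>* v x" using tree by (simp add: is_tree_def)
  then have "x \<in> ?C"
  proof (induction rule: rtranclp_induct)
    case (step y z)
    then show ?case using closed by blast
  qed simp
  then show thesis using that by auto
qed

end


section \<open>Continuants\<close>

text \<open>The determinant of the tridiagonal matrix with diagonal \<open>bs\<close> and \<open>-1\<close> next to the diagonal (see
\<open>det_tridiagonal\<close>); numerators and denominators of continued fractions with minus signs are of this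
form.\<close>

fun continuant :: "int list \<Rightarrow> int" where
  "continuant [] = 1"
| "continuant [b] = b"
| "continuant (b # b' # bs) = b * continuant (b' # bs) - continuant bs"

lemma continuant_pos_less:
  "bs \<noteq> [] \<Longrightarrow> \<forall>b\<in>set bs. b \<ge> 2 \<Longrightarrow>
    0 < continuant (tl bs) \<and> continuant (tl bs) < continuant bs"
proof (induction bs rule: continuant.induct)
  case (3 b b' bs)
  then have IH: "0 < continuant bs" "continuant bs < continuant (b' # bs)" by auto
  then have "2 * continuant (b' # bs) \<le> b * continuant (b' # bs)"
    using 3 by (intro mult_right_mono) auto
  moreover have "continuant (b # b' # bs) = b * continuant (b' # bs) - continuant bs" by simp
  ultimately show ?case unfolding list.sel using IH by linarith
qed auto

lemma continuant_pos: "\<forall>b\<in>set bs. b \<ge> 2 \<Longrightarrow> 0 < continuant bs"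
  using continuant_pos_less[of bs] by (cases "bs = []") auto

lemma coprime_continuant_tl: "bs \<noteq> [] \<Longrightarrow> coprime (continuant bs) (continuant (tl bs))"
proof (induction bs rule: continuant.induct)
  case (3 b b' bs)
  then have "coprime (continuant (b' # bs)) (continuant bs)" by simp
  then have "gcd (continuant (b' # bs)) (b * continuant (b' # bs) - continuant bs) = 1"
    by (metis coprime_iff_gcd_eq_1 gcd_add_mult gcd_neg2 diff_conv_add_uminus add.commute mult.commute)
  then show ?case by (simp add: coprime_iff_gcd_eq_1 gcd.commute)
qed auto

lemma continued_fraction_eq_continuants:
  "bs \<noteq> [] \<Longrightarrow> \<forall>b\<in>set bs. b \<ge> 2 \<Longrightarrow>
    continued_fraction bs = of_int (continuant bs) / of_int (continuant (tl bs))"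
proof (induction bs rule: continuant.induct)
  case (3 b b' bs)
  have "continuant (b' # bs) > 0" by (rule continuant_pos) (use 3 in auto)
  then show ?case using 3 by (auto simp: field_simps)
qed auto

text \<open>The continued fraction is a quotient of continuants, which is in lowest terms by coprimality; a
positive fraction in lowest terms is unique.\<close>

lemma seifert_invariant_eq_continuants:
  assumes "bs \<noteq> []" "\<forall>b\<in>set bs. b \<ge> 2"
  shows "seifert_invariant bs = (continuant bs, continuant (tl bs))"
proof -
  let ?a = "continuant bs" and ?w = "continuant (tl bs)"
  have pos: "0 < ?w" "?w < ?a" using continuant_pos_less[OF assms] by auto
  have uniq: "a = ?a \<and> w = ?w"
    if "of_int a / of_int w = continued_fraction bs" "coprime a w" "0 < w" "w < a" for a w
  proof -
    have "(of_int a / of_int w :: rat) = of_int ?a / of_int ?w"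
      using that continued_fraction_eq_continuants[OF assms] by simp
    then have "of_int (a * ?w) = (of_int (?a * w) :: rat)"
      using that pos by (simp add: frac_eq_eq)
    then have eq: "a * ?w = ?a * w" by (simp only: of_int_eq_iff)
    have "a = ?a"
    proof (rule zdvd_antisym_nonneg)
      have "a dvd ?a * w" "?a dvd a * ?w" using eq by (metis dvd_triv_left)+
      then show "a dvd ?a" "?a dvd a"
        using that(2) coprime_continuant_tl[OF assms(1)] by (simp_all add: coprime_dvd_mult_left_iff)
    qed (use that pos in auto)
    then show ?thesis using eq that by auto
  qed
  show ?thesis unfolding seifert_invariant_def
  proof (rule the_equality)
    show "case (?a, ?w) of (a, w) \<Rightarrow> of_int a / of_int w = continued_fraction bs \<and> coprime a w \<and> 0 < w \<and> w < a"
      using pos coprime_continuant_tl[OF assms(1)] continued_fraction_eq_continuants[OF assms] by simp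
  qed (use uniq in auto)
qed

lemma continuant_append2:
  "continuant (bs @ [a, b]) = b * continuant (bs @ [a]) - continuant bs"
proof (induction bs rule: continuant.induct)
  case (3 c c' bs)
  show ?case using 3[unfolded append_Cons] by (simp only: append_Cons continuant.simps right_diff_distrib) simp
qed (auto simp: algebra_simps)

lemma continuant_rev: "continuant (rev bs) = continuant bs"
  by (induction bs rule: continuant.induct) (auto simp: continuant_append2)

text \<open>Euler's identity; it makes \<open>continuant (tl bs)\<close> and \<open>continuant (butlast bs)\<close> inverse to each other
modulo \<open>continuant bs\<close>.\<close>

lemma continuant_euler_identity:
  "continuant (b' # bs) * continuant (butlast (b # b' # bs))
    - continuant (b # b' # bs) * continuant (butlast (b' # bs)) = 1"
proof (induction bs arbitrary: b b')
  case (Cons b'' bs)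
  have top: "continuant (butlast (b # b' # b'' # bs))
      = b * continuant (butlast (b' # b'' # bs)) - continuant (butlast (b'' # bs))"
    by simp
  have full: "continuant (b # b' # b'' # bs) = b * continuant (b' # b'' # bs) - continuant (b'' # bs)"
    by simp
  show ?case unfolding top full using Cons[where b = b' and b' = b'']
    by (simp add: algebra_simps del: continuant.simps butlast.simps)
qed auto

lemma continuant_dvd:
  "bs \<noteq> [] \<Longrightarrow> continuant bs dvd continuant (tl bs) * continuant (butlast bs) - 1"
proof (induction bs rule: continuant.induct)
  case (3 b b' bs)
  then show ?case using continuant_euler_identity[of b' bs b]
    by (metis diff_diff_eq2 diff_add_cancel add_diff_cancel_left' dvd_triv_left list.sel(3) diff_eq_eq)
qed auto

text \<open>In the applications, \<open>f\<close> lists the coordinates of a vector along a leg or along the chain.  Eliminating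
the inner values leaves a relation between the first two values and the last one.\<close>

lemma continuant_recurrence:
  fixes f :: "nat \<Rightarrow> 'a::comm_ring_1"
  assumes "bs \<noteq> []" "\<And>k. k < length bs \<Longrightarrow> of_int (bs ! k) * f (Suc k) = f k + f (Suc (Suc k))"
  shows "of_int (continuant bs) * f 1 - of_int (continuant (tl bs)) * f 0 = f (Suc (length bs))"
  using assms
proof (induction bs arbitrary: f rule: continuant.induct)
  case (2 b)
  from 2(2)[of 0] show ?case by simp
next
  case (3 b b' bs)
  have last: "f (Suc (Suc (length (b' # bs))))
      = of_int (continuant (b' # bs)) * f (Suc 1) - of_int (continuant bs) * f (Suc 0)"
    using 3(1)[of "\<lambda>k. f (Suc k)"] 3(4)[of "Suc k" for k] by simp
  have f2: "f (Suc 1) = of_int b * f 1 - f 0" using 3(4)[of 0] by simp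
  show ?case using last by (simp add: f2[simplified] algebra_simps)
qed simp

text \<open>Going along a leg or the chain, integrality of the first two coordinates propagates to all others.\<close>

lemma integral_recurrence:
  fixes f :: "nat \<Rightarrow> 'a::comm_ring_1"
  assumes "\<And>k. k < length bs \<Longrightarrow> of_int (bs ! k) * f (Suc k) = f k + f (Suc (Suc k))"
    and "f 0 \<in> \<int>" "f 1 \<in> \<int>"
  shows "k \<le> Suc (length bs) \<Longrightarrow> f k \<in> \<int>"
proof (induction k rule: less_induct)
  case (less k)
  show ?case
  proof (cases "k < 2")
    case True
    then have "k = 0 \<or> k = 1" by auto
    then show ?thesis using assms by auto
  next
    case False
    then obtain j where j: "k = Suc (Suc j)" by (metis add_2_eq_Suc le_add_diff_inverse not_less)
    then have "f k = of_int (bs ! j) * f (Suc j) - f j" using assms(1)[of j] less.prems by simp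
    then show ?thesis using less j by auto
  qed
qed

definition tridiagonal :: "int list \<Rightarrow> int mat" where
  "tridiagonal bs = mat (length bs) (length bs)
     (\<lambda>(i, j). if i = j then bs ! i else if j = Suc i \<or> i = Suc j then -1 else 0)"

text \<open>Laplace expansion along the first row: the first minor is tridiagonal again, and the second one has
only one nonzero entry in its first column.\<close>

lemma det_tridiagonal: "Determinant.det (tridiagonal bs) = continuant bs"
proof (induction bs rule: continuant.induct)
  case 1
  then show ?case by (auto simp: tridiagonal_def)
next
  case (2 b)
  have "tridiagonal [b] \<in> carrier_mat 1 1" by (simp add: tridiagonal_def)
  then show ?case using laplace_expansion_row[of "tridiagonal [b]" 1 0]
    by (simp add: tridiagonal_def cofactor_def mat_delete_def)
next
  case (3 b b' bs)
  let ?n = "length bs"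
  let ?A = "tridiagonal (b # b' # bs)"
  let ?D = "mat_delete ?A 0 1"
  have A: "?A \<in> carrier_mat (Suc (Suc ?n)) (Suc (Suc ?n))" by (simp add: tridiagonal_def)
  have D: "?D \<in> carrier_mat (Suc ?n) (Suc ?n)" using A by (auto simp: mat_delete_def)
  have A00: "mat_delete ?A 0 0 = tridiagonal (b' # bs)"
    by (auto simp: mat_delete_def tridiagonal_def)
  have D00: "mat_delete ?D 0 0 = tridiagonal bs"
    by (auto simp: mat_delete_def tridiagonal_def)
  have "Determinant.det ?D = (\<Sum>i<Suc ?n. ?D $$ (i, 0) * cofactor ?D i 0)"
    by (rule laplace_expansion_column[OF D]) simp
  also have "\<dots> = ?D $$ (0, 0) * cofactor ?D 0 0
      + (\<Sum>i<?n. ?D $$ (Suc i, 0) * cofactor ?D (Suc i) 0)"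
    by (rule sum.lessThan_Suc_shift)
  also have "(\<Sum>i<?n. ?D $$ (Suc i, 0) * cofactor ?D (Suc i) 0) = 0"
    by (rule sum.neutral) (auto simp: mat_delete_def tridiagonal_def)
  also have "?D $$ (0, 0) = -1" by (auto simp: mat_delete_def tridiagonal_def)
  also have "cofactor ?D 0 0 = continuant bs" unfolding cofactor_def D00 using 3 by simp
  finally have detD: "Determinant.det ?D = - continuant bs" by simp
  have "Determinant.det ?A = (\<Sum>j<Suc (Suc ?n). ?A $$ (0, j) * cofactor ?A 0 j)"
    by (rule laplace_expansion_row[OF A]) simp
  also have "\<dots> = ?A $$ (0, 0) * cofactor ?A 0 0 + (?A $$ (0, 1) * cofactor ?A 0 1
      + (\<Sum>j<?n. ?A $$ (0, Suc (Suc j)) * cofactor ?A 0 (Suc (Suc j))))"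
    by (simp only: sum.lessThan_Suc_shift) simp
  also have "(\<Sum>j<?n. ?A $$ (0, Suc (Suc j)) * cofactor ?A 0 (Suc (Suc j))) = 0"
    by (rule sum.neutral) (auto simp: tridiagonal_def)
  also have "?A $$ (0, 0) = b" by (simp add: tridiagonal_def)
  also have "?A $$ (0, 1) = -1" by (simp add: tridiagonal_def)
  also have "cofactor ?A 0 0 = continuant (b' # bs)" using 3 by (simp add: cofactor_def A00)
  also have "cofactor ?A 0 1 = continuant bs" by (simp add: cofactor_def detD[simplified])
  finally show ?case by simp
qed

lemma graph_det_eq_continuant:
  assumes "\<And>i j. i < length xs \<Longrightarrow> j < length xs \<Longrightarrow>
      edge G (xs ! i) (xs ! j) \<longleftrightarrow> j = Suc i \<or> i = Suc j"
    and "distinct xs"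
  shows "graph_det G xs = continuant (map (\<lambda>x. - dec G x) xs)"
proof -
  have "mat (length xs) (length xs) (\<lambda>(i, j). - intersection_number G (xs ! i) (xs ! j))
      = tridiagonal (map (\<lambda>x. - dec G x) xs)"
    by (rule eq_matI)
      (use assms in \<open>auto simp: tridiagonal_def intersection_number_def nth_eq_iff_index_eq\<close>)
  then show ?thesis by (simp add: graph_det_def det_tridiagonal)
qed

section \<open>Sums over nonnegative exponents\<close>

lemma nth_one_minus_X_inverse: "fps_nth (inverse (1 - fps_X :: rat fps)) n = 1"
proof -
  have "inverse (1 - fps_X :: rat fps) = Abs_fps (\<lambda>n. 1)"
    using fps_inverse_idempotent[of "Abs_fps (\<lambda>n. 1::rat)"] fps_inverse_gp'[where 'a = rat] by simp
  then show ?thesis by simp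
qed

text \<open>The power of \<open>1 / (1 - X)\<close> is the generating function of the number of ways to write \<open>n\<close> as an
ordered sum of natural numbers.\<close>

lemma card_PiE_sum_eq:
  assumes "finite I"
  shows "finite {y \<in> I \<rightarrow>\<^sub>E (UNIV :: nat set). sum y I = n} \<and>
    of_nat (card {y \<in> I \<rightarrow>\<^sub>E (UNIV :: nat set). sum y I = n})
      = fps_nth (inverse (1 - fps_X :: rat fps) ^ card I) n"
  using assms
proof (induction I arbitrary: n rule: finite_induct)
  case empty
  have "{y. y = (\<lambda>x. undefined) \<and> (0::nat) = n} = (if n = 0 then {\<lambda>x. undefined} else {})" by auto
  then show ?case by (auto simp: PiE_empty_domain)
next
  case (insert i I)
  let ?S = "\<lambda>I n. {y \<in> I \<rightarrow>\<^sub>E (UNIV :: nat set). sum y I = n}"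
  let ?T = "SIGMA k:{0..n}. ?S I (n - k)"
  have sum_upd: "sum (y(i := k)) I = sum y I" for y :: "'a \<Rightarrow> nat" and k
    using insert by (intro sum.cong) auto
  have bij: "bij_betw (\<lambda>(k, y). y(i := k)) ?T (?S (insert i I) n)"
    unfolding bij_betw_def
  proof
    show "inj_on (\<lambda>(k, y). y(i := k)) ?T"
    proof (rule inj_onI)
      fix p q assume pq: "p \<in> ?T" "q \<in> ?T" "(\<lambda>(k, y). y(i := k)) p = (\<lambda>(k, y). y(i := k)) q"
      obtain k y k' y' where [simp]: "p = (k, y)" "q = (k', y')" by (metis surj_pair)
      have "y \<in> I \<rightarrow>\<^sub>E UNIV" "y' \<in> I \<rightarrow>\<^sub>E UNIV" and upd: "y(i := k) = y'(i := k')"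
        using pq by (simp_all del: fun_upd_apply)
      then have "y i = y' i" using insert(2) PiE_arb[of _ I _ i] by metis
      then have "y = y'" using upd by (metis fun_upd_triv fun_upd_upd)
      moreover have "k = k'" using upd by (metis fun_upd_same)
      ultimately show "p = q" by simp
    qed
    show "(\<lambda>(k, y). y(i := k)) ` ?T = ?S (insert i I) n"
    proof (intro equalityI subsetI)
      fix z assume "z \<in> (\<lambda>(k, y). y(i := k)) ` ?T"
      then obtain k y where z: "z = y(i := k)" and k: "k \<le> n" and y: "y \<in> ?S I (n - k)" by auto
      have "sum z (insert i I) = k + sum y I"
        unfolding z sum.insert[OF insert(1,2)] sum_upd by simp
      moreover have "z \<in> insert i I \<rightarrow>\<^sub>E UNIV"
        using y by (auto simp: z PiE_iff extensional_def)
      ultimately show "z \<in> ?S (insert i I) n" using k y by simp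
    next
      fix y assume y: "y \<in> ?S (insert i I) n"
      then have "y i + sum y I = n" using insert by simp
      moreover have "y(i := undefined) \<in> I \<rightarrow>\<^sub>E (UNIV :: nat set)"
        using y insert by (auto simp: PiE_iff extensional_def)
      ultimately have "(y i, y(i := undefined)) \<in> ?T" 
        using sum_upd[of y undefined] by (auto simp del: fun_upd_apply)
      then show "y \<in> (\<lambda>(k, y). y(i := k)) ` ?T" by (rule rev_image_eqI) simp
    qed
  qed
  have fin: "finite ?T" using insert by auto
  have "card (?S (insert i I) n) = card ?T" using bij_betw_same_card[OF bij] by simp
  also have "\<dots> = (\<Sum>k=0..n. card (?S I (n - k)))" using insert by simp
  finally have "(of_nat (card (?S (insert i I) n)) :: rat)
      = (\<Sum>k=0..n. of_nat (card (?S I (n - k))))" by simp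
  also have "\<dots> = (\<Sum>k=0..n. fps_nth (inverse (1 - fps_X :: rat fps)) k
      * fps_nth (inverse (1 - fps_X :: rat fps) ^ card I) (n - k))"
    using insert by (simp add: nth_one_minus_X_inverse)
  also have "\<dots> = fps_nth (inverse (1 - fps_X :: rat fps) ^ card (insert i I)) n"
    using insert by (simp add: fps_mult_nth)
  finally show ?case using fin bij bij_betw_finite by blast
qed

text \<open>The sum is the coefficient of \<open>X ^ n\<close> in \<open>(1 - X) ^ (d - 1) * (1 / (1 - X)) ^ d = 1 / (1 - X)\<close>.\<close>

lemma node_sum_eq_1:
  assumes "d \<ge> 1"
  shows "finite {(k, y). y \<in> {1..d} \<rightarrow>\<^sub>E (UNIV :: nat set) \<and> k + sum y {1..d} = n}"
    and "(\<Sum>(k, y) | y \<in> {1..d} \<rightarrow>\<^sub>E (UNIV :: nat set) \<and> k + sum y {1..d} = n.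
      fps_nth ((1 - fps_X :: rat fps) ^ (d - 1)) k) = 1"
proof -
  let ?u = "1 - fps_X :: rat fps"
  let ?S = "\<lambda>n. {y \<in> {1..d} \<rightarrow>\<^sub>E (UNIV :: nat set). sum y {1..d} = n}"
  have eq: "{(k, y). y \<in> {1..d} \<rightarrow>\<^sub>E (UNIV :: nat set) \<and> k + sum y {1..d} = n}
      = (SIGMA k:{0..n}. ?S (n - k))" by auto
  have S: "finite (?S m)" "of_nat (card (?S m)) = fps_nth (inverse ?u ^ d) m" for m
    using card_PiE_sum_eq[of "{1..d}" m] by auto
  show "finite {(k, y). y \<in> {1..d} \<rightarrow>\<^sub>E (UNIV :: nat set) \<and> k + sum y {1..d} = n}"
    unfolding eq using S by auto
  have "(\<Sum>(k, y) | y \<in> {1..d} \<rightarrow>\<^sub>E (UNIV :: nat set) \<and> k + sum y {1..d} = n.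
      fps_nth (?u ^ (d - 1)) k) = (\<Sum>k=0..n. \<Sum>y\<in>?S (n - k). fps_nth (?u ^ (d - 1)) k)"
    unfolding eq using S by (subst sum.Sigma) auto
  also have "\<dots> = (\<Sum>k=0..n. fps_nth (?u ^ (d - 1)) k * fps_nth (inverse ?u ^ d) (n - k))"
    using S(2) by (simp add: mult.commute)
  also have "\<dots> = fps_nth (?u ^ (d - 1) * inverse ?u ^ d) n" by (simp add: fps_mult_nth)
  also have "?u ^ (d - 1) * inverse ?u ^ d = inverse ?u"
  proof -
    have "?u * inverse ?u = 1" by (rule inverse_mult_eq_1') simp
    then have "?u ^ (d - 1) * inverse ?u ^ (d - 1) = 1"
      by (metis power_mult_distrib power_one)
    then show ?thesis using assms by (cases d) (auto simp: ac_simps)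
  qed
  finally show "(\<Sum>(k, y) | y \<in> {1..d} \<rightarrow>\<^sub>E (UNIV :: nat set) \<and> k + sum y {1..d} = n.
      fps_nth (?u ^ (d - 1)) k) = 1" by (simp add: nth_one_minus_X_inverse)
qed

text \<open>The congruences say that \<open>y i\<close> has a prescribed remainder modulo \<open>\<alpha> i\<close>, so \<open>y i\<close> may be replaced by
its quotient \<open>z i = y i div \<alpha> i\<close>, an arbitrary natural number.  The equation then reads
\<open>k + (\<Sum>i. z i) = N\<close>, and the claim becomes \<open>node_sum_eq_1\<close>.\<close>

lemma residue_sum:
  fixes \<alpha> \<rho> :: "nat \<Rightarrow> int" and M :: int
  assumes d: "d \<ge> 1" and pos: "\<And>i. i \<in> {1..d} \<Longrightarrow> \<alpha> i > 0"
  defines "S \<equiv> {(k, y). y \<in> {1..d} \<rightarrow>\<^sub>E (UNIV :: nat set)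
      \<and> (\<forall>i\<in>{1..d}. \<alpha> i dvd int (y i) - \<rho> i)
      \<and> int k + (\<Sum>i=1..d. (int (y i) - \<rho> i) div \<alpha> i) = M}"
    and "N \<equiv> M + (\<Sum>i=1..d. \<rho> i div \<alpha> i)"
  shows "finite S"
    and "(\<Sum>(k, y)\<in>S. fps_nth ((1 - fps_X :: rat fps) ^ (d - 1)) k) = (if N \<ge> 0 then 1 else 0)"
proof -
  let ?B = "{(k, z). z \<in> {1..d} \<rightarrow>\<^sub>E (UNIV :: nat set) \<and> k + sum z {1..d} = nat N}"
  let ?to = "\<lambda>(k::nat, y). (k, \<lambda>i\<in>{1..d}. nat (int (y i) div \<alpha> i))"
  let ?from = "\<lambda>(k::nat, z). (k, \<lambda>i\<in>{1..d}. nat (\<alpha> i * int (z i) + \<rho> i mod \<alpha> i))"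
  have quot: "int (y i) div \<alpha> i = (int (y i) - \<rho> i) div \<alpha> i + \<rho> i div \<alpha> i"
    and rem: "\<alpha> i * (int (y i) div \<alpha> i) + \<rho> i mod \<alpha> i = int (y i)"
    if i: "i \<in> {1..d}" and dvd: "\<alpha> i dvd int (y i) - \<rho> i" for y :: "nat \<Rightarrow> nat" and i
  proof -
    obtain t where "int (y i) - \<rho> i = \<alpha> i * t" using dvd by blast
    then have t: "int (y i) = \<rho> i + \<alpha> i * t" by simp
    then show "int (y i) div \<alpha> i = (int (y i) - \<rho> i) div \<alpha> i + \<rho> i div \<alpha> i"
      using pos[OF i] by simp
    have "int (y i) mod \<alpha> i = \<rho> i mod \<alpha> i" unfolding t by simp
    then show "\<alpha> i * (int (y i) div \<alpha> i) + \<rho> i mod \<alpha> i = int (y i)"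
      by (metis mult_div_mod_eq)
  qed
  have S_sum: "int k + (\<Sum>i=1..d. int (y i) div \<alpha> i) = N" if "(k, y) \<in> S" for k y
  proof -
    have "(\<Sum>i=1..d. int (y i) div \<alpha> i)
        = (\<Sum>i=1..d. (int (y i) - \<rho> i) div \<alpha> i) + (\<Sum>i=1..d. \<rho> i div \<alpha> i)"
      unfolding sum.distrib[symmetric] by (rule sum.cong) (use that quot in \<open>auto simp: S_def\<close>)
    then show ?thesis using that by (simp add: S_def N_def)
  qed
  have nonneg: "0 \<le> int n div \<alpha> i" if "i \<in> {1..d}" for n i
    using pos[OF that] by (simp add: pos_imp_zdiv_nonneg_iff)
  have empty: "S = {}" if "N < 0"
  proof -
    have False if "(k, y) \<in> S" for k y
      using S_sum[OF that] sum_nonneg[of "{1..d}" "\<lambda>i. int (y i) div \<alpha> i"] nonneg \<open>N < 0\<close> by force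
    then show ?thesis by auto
  qed
  have to: "?to p \<in> ?B" "?from (?to p) = p" if "p \<in> S" for p
  proof -
    obtain k y where p: "p = (k, y)" by force
    have y: "y \<in> {1..d} \<rightarrow>\<^sub>E UNIV" "\<And>i. i \<in> {1..d} \<Longrightarrow> \<alpha> i dvd int (y i) - \<rho> i"
      using that by (auto simp: S_def p)
    have "int (k + (\<Sum>i=1..d. nat (int (y i) div \<alpha> i))) = N"
      using S_sum[of k y] that nonneg by (simp add: p)
    then have "k + (\<Sum>i=1..d. nat (int (y i) div \<alpha> i)) = nat N" by linarith
    then show "?to p \<in> ?B" by (simp add: p)
    have "nat (\<alpha> i * int (nat (int (y i) div \<alpha> i)) + \<rho> i mod \<alpha> i) = y i" if "i \<in> {1..d}" for i
      using rem[where y = y, OF that y(2)[OF that]] nonneg[OF that] by simp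
    then show "?from (?to p) = p"
      using y(1) by (auto simp: p PiE_iff extensional_def restrict_def fun_eq_iff)
  qed
  have "from": "?from q \<in> S" "?to (?from q) = q" if q: "q \<in> ?B" and N: "N \<ge> 0" for q
  proof -
    obtain k z where q': "q = (k, z)" by force
    have z: "z \<in> {1..d} \<rightarrow>\<^sub>E UNIV" "int k + (\<Sum>i=1..d. int (z i)) = N"
      using q N by (auto simp: q' of_nat_sum[symmetric] simp del: of_nat_sum)
    have int: "int (nat (\<alpha> i * int (z i) + \<rho> i mod \<alpha> i)) = \<alpha> i * int (z i) + \<rho> i mod \<alpha> i"
      and diff: "\<alpha> i * int (z i) + \<rho> i mod \<alpha> i - \<rho> i = \<alpha> i * (int (z i) - \<rho> i div \<alpha> i)"
      if "i \<in> {1..d}" for i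
    proof -
      have "0 \<le> \<alpha> i * int (z i)" "0 \<le> \<rho> i mod \<alpha> i" using pos[OF that] by auto
      then show "int (nat (\<alpha> i * int (z i) + \<rho> i mod \<alpha> i)) = \<alpha> i * int (z i) + \<rho> i mod \<alpha> i"
        by simp
      show "\<alpha> i * int (z i) + \<rho> i mod \<alpha> i - \<rho> i = \<alpha> i * (int (z i) - \<rho> i div \<alpha> i)"
        by (simp add: minus_div_mult_eq_mod[symmetric] algebra_simps)
    qed
    have dv: "(\<alpha> i * int (z i) + \<rho> i mod \<alpha> i - \<rho> i) div \<alpha> i = int (z i) - \<rho> i div \<alpha> i"
      if "i \<in> {1..d}" for i
      unfolding diff[OF that] using pos[OF that] by simp
    have "int k + (\<Sum>i=1..d. int (z i) - \<rho> i div \<alpha> i) = M"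
      using z(2) by (simp add: sum_subtractf N_def)
    then show "?from q \<in> S"
      using int diff dv by (simp add: S_def q')
    have "nat ((\<alpha> i * int (z i) + \<rho> i mod \<alpha> i) div \<alpha> i) = z i" if "i \<in> {1..d}" for i
      using pos[OF that] by (simp add: div_add1_eq)
    then show "?to (?from q) = q"
      using z(1) int by (auto simp: q' PiE_iff extensional_def restrict_def fun_eq_iff)
  qed
  have bij: "bij_betw ?to S ?B" if "N \<ge> 0"
  proof (rule bij_betw_byWitness[where f' = ?from])
    show "\<forall>p\<in>S. ?from (?to p) = p" by (rule ballI) (rule to(2))
    show "\<forall>q\<in>?B. ?to (?from q) = q" by (rule ballI) (rule "from"(2)[OF _ that])
    show "?to ` S \<subseteq> ?B" by (rule image_subsetI) (rule to(1))
    show "?from ` ?B \<subseteq> S" by (rule image_subsetI) (rule "from"(1)[OF _ that])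
  qed
  show "finite S"
  proof (cases "N \<ge> 0")
    case True
    show ?thesis using bij_betw_finite[OF bij[OF True]] node_sum_eq_1(1)[OF d, of "nat N"] by simp
  qed (use empty in simp)
  show "(\<Sum>(k, y)\<in>S. fps_nth ((1 - fps_X :: rat fps) ^ (d - 1)) k) = (if N \<ge> 0 then 1 else 0)"
  proof (cases "N \<ge> 0")
    case True
    have "(\<Sum>(k, y)\<in>S. fps_nth ((1 - fps_X :: rat fps) ^ (d - 1)) k)
        = (\<Sum>q\<in>?B. fps_nth ((1 - fps_X :: rat fps) ^ (d - 1)) (fst q))"
      using sum.reindex_bij_betw[OF bij[OF True], of "\<lambda>q. fps_nth ((1 - fps_X :: rat fps) ^ (d - 1)) (fst q)"]
      by (simp add: case_prod_unfold)
    then show ?thesis using node_sum_eq_1(2)[OF d, of "nat N"] True by (simp add: case_prod_unfold)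
  qed (use empty in simp)
qed


section \<open>The dual basis\<close>

lemma form_E_base:
  "form G x (E_base w) = (\<Sum>v\<in>UNIV. x v * of_int (intersection_number G v w))"
proof -
  have "(\<Sum>w'\<in>UNIV. x v * E_base w w' * of_int (intersection_number G v w'))
      = x v * of_int (intersection_number G v w)" for v
    by (simp add: E_base_def if_distrib[of "\<lambda>t. _ * t"] if_distrib[of "\<lambda>t. t * _"] cong: if_cong)
  then show ?thesis by (simp add: form_def)
qed

lemma form_eq_sum: "form G x y = (\<Sum>w\<in>UNIV. y w * form G x (E_base w))"
  unfolding form_E_base unfolding form_def sum_distrib_left by (subst sum.swap) (simp add: ac_simps)

lemma form_diff: "form G (\<lambda>v. x v - y v) z = form G x z - form G y z"
  by (simp add: form_def left_diff_distrib sum_subtractf)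

lemma form_add: "form G (\<lambda>v. x v + y v) z = form G x z + form G y z"
  by (simp add: form_def distrib_right sum.distrib)

lemma form_scale: "form G (\<lambda>v. a * x v) z = a * form G x z"
  by (simp add: form_def sum_distrib_left ac_simps)

lemma form_sum: "form G (\<lambda>v. \<Sum>i\<in>I. x i v) z = (\<Sum>i\<in>I. form G (x i) z)"
proof (induction I rule: infinite_finite_induct)
  case (insert i I)
  then show ?case by (simp add: form_add)
qed (simp_all add: form_def)

lemma form_E_base_neighbours:
  assumes "symp (edge G)" "irreflp (edge G)"
  shows "form G x (E_base w) = of_int (dec G w) * x w + (\<Sum>u | edge G w u. x u)"
proof -
  have "form G x (E_base w) = x w * of_int (intersection_number G w w)
      + (\<Sum>v\<in>UNIV - {w}. x v * of_int (intersection_number G v w))"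
    unfolding form_E_base by (rule sum.remove) auto
  also have "(\<Sum>v\<in>UNIV - {w}. x v * of_int (intersection_number G v w))
      = (\<Sum>v | edge G w v. x v)"
    by (rule sum.mono_neutral_cong_right)
      (use assms in \<open>auto simp: intersection_number_def irreflp_def dest: sympD\<close>)
  finally show ?thesis by (simp add: intersection_number_def ac_simps)
qed

lemma clear_denominators:
  fixes x :: "'v::finite \<Rightarrow> rat"
  obtains N :: int where "N > 0" "\<And>v. of_int N * x v \<in> \<int>"
proof
  let ?d = "\<lambda>v. snd (quotient_of (x v))"
  show "(\<Prod>v\<in>UNIV. ?d v) > 0" by (intro prod_pos) (auto intro: quotient_of_denom_pos')
  fix v
  have "x v = of_int (fst (quotient_of (x v))) / of_int (?d v)"
    by (rule quotient_of_div) simp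
  moreover have "?d v \<noteq> 0" using quotient_of_denom_pos'[of "x v"] by simp
  ultimately have "of_int (?d v) * x v = of_int (fst (quotient_of (x v)))"
    by (metis nonzero_mult_div_cancel_left of_int_eq_0_iff times_divide_eq_right)
  moreover have "(\<Prod>v\<in>UNIV. ?d v) = (\<Prod>v\<in>UNIV - {v}. ?d v) * ?d v"
    by (subst prod.remove[of UNIV v]) (auto simp: mult.commute)
  ultimately have "of_int (\<Prod>v\<in>UNIV. ?d v) * x v
      = of_int ((\<Prod>v\<in>UNIV - {v}. ?d v) * fst (quotient_of (x v)))"
    by (simp add: mult.assoc)
  then show "of_int (\<Prod>v\<in>UNIV. ?d v) * x v \<in> \<int>" by (metis Ints_of_int)
qed

text \<open>Negative definiteness is a statement about integral vectors only; a rational vector of the kernel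
becomes integral after clearing denominators.\<close>

lemma form_nondegenerate:
  assumes "negative_definite G" "\<And>w. form G x (E_base w) = 0"
  shows "x = (\<lambda>_. 0)"
proof -
  obtain N :: int where N: "N > 0" "\<And>v. of_int N * x v \<in> \<int>"
    using clear_denominators[of x] by blast
  let ?l = "\<lambda>v. of_int N * x v"
  have "form G ?l ?l = 0"
    by (subst form_eq_sum) (simp add: form_scale assms(2))
  moreover have "?l \<in> int_lattice" using N by (simp add: int_lattice_def)
  ultimately have "?l = (\<lambda>_. 0)" using assms(1) unfolding negative_definite_def by fastforce
  then show ?thesis using N by (auto simp: fun_eq_iff)
qed

lemma form_eqI:
  assumes "negative_definite G" "\<And>w. form G x (E_base w) = form G y (E_base w)"
  shows "x = y"
proof -
  have "(\<lambda>v. x v - y v) = (\<lambda>_. 0)"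
    by (rule form_nondegenerate[OF assms(1)]) (simp add: form_diff assms(2))
  then show ?thesis by (simp add: fun_eq_iff)
qed

lemma dual_latticeI:
  assumes "\<And>w. form G x (E_base w) \<in> \<int>"
  shows "x \<in> dual_lattice G"
  unfolding dual_lattice_def
proof safe
  fix l :: "'a \<Rightarrow> rat" assume "l \<in> int_lattice"
  then show "form G x l \<in> \<int>"
    using assms by (subst form_eq_sum) (auto intro!: Ints_sum Ints_mult simp: int_lattice_def)
qed

text \<open>A nondegenerate form gives an injective, hence surjective, linear map.\<close>

lemma form_solvable:
  fixes G :: "('v::finite, 'z) plumbing_graph_scheme"
  assumes "negative_definite G"
  shows "\<exists>x. \<forall>w. form G x (E_base w) = b w"
proof -
  define M :: "rat^'v^'v" where "M = vec_lambda (\<lambda>i. vec_lambda (\<lambda>j. of_int (intersection_number G j i)))"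
  have M: "vec_nth (M *v x) w = form G (vec_nth x) (E_base w)" for x w
    by (simp add: matrix_vector_mult_def M_def form_E_base mult.commute)
  have "inj ((*v) M)"
  proof (rule injI)
    fix x y assume "M *v x = M *v y"
    then have "vec_nth x = vec_nth y"
      by (intro form_eqI[OF assms]) (metis M)
    then show "x = y" by (simp add: vec_nth_inject)
  qed
  then obtain B where "B ** M = Finite_Cartesian_Product.mat 1"
    using matrix_left_invertible_injective by blast
  then have "M ** B = Finite_Cartesian_Product.mat 1" by (simp add: matrix_left_right_inverse)
  then have "M *v (B *v (vec_lambda b)) = vec_lambda b"
    by (simp add: matrix_vector_mul_assoc)
  then have "form G (vec_nth (B *v (vec_lambda b))) (E_base w) = b w" for w
    by (metis M vec_lambda_beta)
  then show ?thesis by blast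
qed

lemma form_E_dual:
  fixes G :: "('v::finite, 'z) plumbing_graph_scheme"
  assumes "negative_definite G"
  shows "form G (E_dual G v) (E_base w) = (if v = w then -1 else 0)"
proof -
  obtain x where x: "form G x (E_base w) = (if v = w then -1 else 0)" for w
    using form_solvable[OF assms, of "\<lambda>w. if v = w then -1 else 0"] by blast
  have "x \<in> dual_lattice G" by (rule dual_latticeI) (simp add: x)
  have "E_dual G v = x"
    unfolding E_dual_def
  proof (rule the_equality)
    show "x \<in> dual_lattice G \<and> (\<forall>w. form G x (E_base w) = (if v = w then -1 else 0))"
      using \<open>x \<in> dual_lattice G\<close> x by simp
    fix y assume "y \<in> dual_lattice G \<and> (\<forall>w. form G y (E_base w) = (if v = w then -1 else 0))"
    then show "y = x" by (intro form_eqI[OF assms]) (simp add: x)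
  qed
  then show ?thesis using x by simp
qed

lemma disc_class_eq_iff:
  assumes "x \<in> dual_lattice G" "y \<in> dual_lattice G"
  shows "disc_class G x = disc_class G y \<longleftrightarrow> (\<lambda>v. x v - y v) \<in> int_lattice"
proof -
  have "equiv (dual_lattice G) (lattice_rel G)"
  proof (rule equivI)
    have "y v - x v \<in> \<int>" if "x v - y v \<in> \<int>" for x y :: "'a \<Rightarrow> rat" and v
      using Ints_minus[OF that] by simp
    then show "sym (lattice_rel G)" by (auto simp: sym_def lattice_rel_def int_lattice_def)
    have "x v - z v \<in> \<int>" if "x v - y v \<in> \<int>" "y v - z v \<in> \<int>" for x y z :: "'a \<Rightarrow> rat" and v
      using Ints_add[OF that] by simp
    then show "trans (lattice_rel G)"
      unfolding trans_def lattice_rel_def int_lattice_def by blast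
  qed (auto simp: refl_on_def lattice_rel_def int_lattice_def)
  then have "disc_class G x = disc_class G y \<longleftrightarrow> (x, y) \<in> lattice_rel G"
    unfolding disc_class_def using assms by (rule eq_equiv_class_iff)
  then show ?thesis using assms by (simp add: lattice_rel_def)
qed

section \<open>Linear relations along legs and chains\<close>

context two_nodes
begin

lemma form_nbr: "form G x (E_base u) = of_int (dec G u) * x u + (\<Sum>y | edge G u y. x y)"
  using tree by (intro form_E_base_neighbours) (auto simp: is_tree_def)

text \<open>Pairing with the leg's vertices gives the recurrence of \<open>continuant_recurrence\<close>.  The last vertex
has only one neighbour; with \<open>m\<close> in place of the missing value its equation has the same form.\<close>

lemma leg_relation:
  fixes x :: "'v \<Rightarrow> rat"
  assumes leg: "is_leg G v xs"
    and inner: "\<And>u. u \<in> set (butlast xs) \<Longrightarrow> form G x (E_base u) = 0"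
    and at_end: "form G x (E_base (last xs)) = - m"
  defines "bs \<equiv> map (\<lambda>u. - dec G u) xs"
  shows "of_int (continuant bs) * x (hd xs) - of_int (continuant (tl bs)) * x v = m"
    and "x v \<in> \<int> \<Longrightarrow> x (hd xs) \<in> \<int> \<Longrightarrow> u \<in> set xs \<Longrightarrow> x u \<in> \<int>"
proof -
  define f where "f k = (if k \<le> length xs then x ((v # xs) ! k) else m)" for k
  have xs: "xs \<noteq> []" by (rule legD(1)[OF leg])
  have rec: "of_int (bs ! k) * f (Suc k) = f k + f (Suc (Suc k))" if "k < length bs" for k
  proof (cases "Suc k < length xs")
    case True
    have "xs ! k \<in> set (butlast xs)"
      using True by (metis Suc_lessE diff_Suc_1 length_butlast nth_butlast nth_mem Suc_less_eq)
    then have "form G x (E_base (xs ! k)) = 0" by (rule inner)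
    then have "of_int (dec G (xs ! k)) * x (xs ! k) + (x ((v # xs) ! k) + x (xs ! Suc k)) = 0"
      using leg_inner_neighbours[OF leg True] by (simp add: form_nbr)
    then show ?thesis using True by (simp add: f_def bs_def)
  next
    case False
    then have k: "length xs = Suc k" using that by (simp add: bs_def)
    then have l: "last xs = xs ! k" using xs by (simp add: last_conv_nth)
    have "of_int (dec G (last xs)) * x (last xs) + x ((v # xs) ! k) = - m"
      using at_end leg_last_neighbours[OF leg] k by (simp add: form_nbr)
    then show ?thesis using k by (simp add: f_def bs_def l)
  qed
  have f: "f 0 = x v" "f 1 = x (hd xs)" "f (Suc (length bs)) = m"
    using xs by (auto simp: f_def bs_def hd_conv_nth Suc_le_eq)
  show "of_int (continuant bs) * x (hd xs) - of_int (continuant (tl bs)) * x v = m"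
    using continuant_recurrence[of bs f] rec xs f by (simp add: bs_def)
  assume int: "x v \<in> \<int>" "x (hd xs) \<in> \<int>" and "u \<in> set xs"
  then obtain k where k: "k < length xs" "u = xs ! k" by (auto simp: in_set_conv_nth)
  have "f (Suc k) \<in> \<int>"
    by (rule integral_recurrence[of bs f]) (use rec int f k in \<open>auto simp: bs_def\<close>)
  then show "x u \<in> \<int>" using k by (simp add: f_def)
qed

text \<open>As for legs, with a value at either end; the inhomogeneous terms \<open>p\<close> at the first and \<open>q\<close> at the
last vertex are absorbed into the values at the nodes.  Both are allowed so that the lemma can be used
for the chain and for its reversal.\<close>

lemma chain_relation:
  fixes x :: "'v \<Rightarrow> rat"
  assumes rel: "\<And>u. u \<in> set ch \<Longrightarrow> form G x (E_base u)
      = - (if u = hd ch then p else 0) - (if u = last ch then q else 0)"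
  defines "bs \<equiv> map (\<lambda>u. - dec G u) ch"
  shows "of_int (continuant bs) * x (hd ch) - of_int (continuant (tl bs)) * (x v + p) = x w + q"
    and "x v + p \<in> \<int> \<Longrightarrow> x (hd ch) \<in> \<int> \<Longrightarrow> u \<in> set ch \<Longrightarrow> x u \<in> \<int>"
proof -
  define f where "f k = x ((v # ch @ [w]) ! k) + (if k = 0 then p else 0)
      + (if k = Suc (length ch) then q else 0)" for k
  have dist: "distinct ch" using chain_path by (simp add: is_path_def)
  have rec: "of_int (bs ! k) * f (Suc k) = f k + f (Suc (Suc k))" if "k < length bs" for k
  proof -
    have k: "k < length ch" using that by (simp add: bs_def)
    have first: "ch ! k = hd ch \<longleftrightarrow> k = 0" and final: "ch ! k = last ch \<longleftrightarrow> Suc k = length ch"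
      using k dist chain_nonempty
      by (auto simp: hd_conv_nth last_conv_nth nth_eq_iff_index_eq)
    have nbrs: "(v # ch @ [w]) ! k = (v # ch) ! k" "(v # ch @ [w]) ! Suc k = ch ! k"
      using k by (auto simp: nth_append nth_Cons split: nat.split)
    have "of_int (dec G (ch ! k)) * x (ch ! k) + (x ((v # ch) ! k) + x ((ch @ [w]) ! Suc k))
        = - (if k = 0 then p else 0) - (if Suc k = length ch then q else 0)"
      using rel[of "ch ! k"] chain_neighbours[OF k] k first final by (simp add: form_nbr)
    then show ?thesis using k nbrs by (simp add: f_def bs_def split: if_splits)
  qed
  have f: "f 0 = x v + p" "f 1 = x (hd ch)" "f (Suc (length bs)) = x w + q"
    using chain_nonempty by (auto simp: f_def bs_def hd_conv_nth nth_append)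
  show "of_int (continuant bs) * x (hd ch) - of_int (continuant (tl bs)) * (x v + p) = x w + q"
    using continuant_recurrence[of bs f] rec chain_nonempty f by (simp add: bs_def)
  assume int: "x v + p \<in> \<int>" "x (hd ch) \<in> \<int>" and "u \<in> set ch"
  then obtain k where k: "k < length ch" "u = ch ! k" by (auto simp: in_set_conv_nth)
  show "x u \<in> \<int>"
  proof -
    have "f (Suc k) \<in> \<int>"
      by (rule integral_recurrence[of bs f]) (use rec int f k in \<open>auto simp: bs_def\<close>)
    then show ?thesis using k by (simp add: f_def nth_append)
  qed
qed

lemma chain_induced:
  assumes "i < length ch" "j < length ch"
  shows "edge G (ch ! i) (ch ! j) \<longleftrightarrow> j = Suc i \<or> i = Suc j"
proof -
  have dist: "distinct (v # ch @ [w])" using chain_path by (simp add: is_path_def)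
  have "edge G (ch ! i) (ch ! j) \<longleftrightarrow> ch ! j = (v # ch) ! i \<or> ch ! j = (ch @ [w]) ! Suc i"
    using chain_neighbours[OF assms(1)] by blast
  also have "ch ! j = (v # ch) ! i \<longleftrightarrow> i = Suc j"
    using assms dist by (cases i) (auto simp: nth_eq_iff_index_eq)
  also have "ch ! j = (ch @ [w]) ! Suc i \<longleftrightarrow> j = Suc i"
    using assms dist by (auto simp: nth_append nth_eq_iff_index_eq)
  finally show ?thesis by auto
qed

lemma graph_det_chain:
  "graph_det G ch = continuant (map (\<lambda>x. - dec G x) ch)"
  "graph_det G (tl ch) = continuant (tl (map (\<lambda>x. - dec G x) ch))"
  "graph_det G (butlast ch) = continuant (butlast (map (\<lambda>x. - dec G x) ch))"
proof -
  have dist: "distinct ch" using chain_path by (simp add: is_path_def)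
  show "graph_det G ch = continuant (map (\<lambda>x. - dec G x) ch)"
    by (rule graph_det_eq_continuant) (use chain_induced dist in auto)
  have "graph_det G (tl ch) = continuant (map (\<lambda>x. - dec G x) (tl ch))"
    by (rule graph_det_eq_continuant) (use chain_induced dist in \<open>auto simp: nth_tl distinct_tl\<close>)
  then show "graph_det G (tl ch) = continuant (tl (map (\<lambda>x. - dec G x) ch))" by (simp add: map_tl)
  have "graph_det G (butlast ch) = continuant (map (\<lambda>x. - dec G x) (butlast ch))"
    by (rule graph_det_eq_continuant)
      (use chain_induced dist in \<open>auto simp: nth_butlast distinct_butlast\<close>)
  then show "graph_det G (butlast ch) = continuant (butlast (map (\<lambda>x. - dec G x) ch))"
    by (simp add: map_butlast)
qed

lemma inj_on_leg_heads: "inj_on hd {xs. is_leg G v xs}"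
proof (rule inj_onI, simp)
  fix xs ys assume *: "is_leg G v xs" "is_leg G v ys" "hd xs = hd ys"
  then have "hd xs \<in> set xs \<inter> set ys" using legD(1) by (metis IntI hd_in_set)
  then show "xs = ys" using leg_eq * by blast
qed

lemma node_relation:
  assumes "bij_betw leg {1..d} {xs. is_leg G v xs}"
  shows "form G x (E_base v) = of_int (dec G v) * x v + x (hd ch) + (\<Sum>i=1..d. x (hd (leg i)))"
    and "valency G v = d + 1"
proof -
  have bij: "bij_betw (\<lambda>i. hd (leg i)) {1..d} (hd ` {xs. is_leg G v xs})"
    using bij_betw_trans[OF assms inj_on_imp_bij_betw[OF inj_on_leg_heads]] by (simp add: comp_def)
  have fin: "finite (hd ` {xs. is_leg G v xs})" by simp
  have new: "hd ch \<notin> hd ` {xs. is_leg G v xs}" using leg_head_not_chain by force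
  have "(\<Sum>y | edge G v y. x y) = x (hd ch) + (\<Sum>y\<in>hd ` {xs. is_leg G v xs}. x y)"
    unfolding node_neighbours by (rule sum.insert[OF fin new])
  also have "(\<Sum>y\<in>hd ` {xs. is_leg G v xs}. x y) = (\<Sum>i=1..d. x (hd (leg i)))"
    by (rule sum.reindex_bij_betw[OF bij, symmetric])
  finally show "form G x (E_base v)
      = of_int (dec G v) * x v + x (hd ch) + (\<Sum>i=1..d. x (hd (leg i)))"
    by (simp add: form_nbr)
  have "card (hd ` {xs. is_leg G v xs}) = d" using bij_betw_same_card[OF bij] by simp
  then show "valency G v = d + 1"
    unfolding valency_def node_neighbours using fin new by simp
qed

end


section \<open>Lifts\<close>

lemma (in two_nodes) leg_seifert_invariant:
  assumes "is_leg G v xs" "\<forall>x\<in>set xs. dec G x \<le> -2"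
  shows "seifert_invariant (map (\<lambda>x. - dec G x) xs)
    = (continuant (map (\<lambda>x. - dec G x) xs), continuant (tl (map (\<lambda>x. - dec G x) xs)))"
    and "continuant (map (\<lambda>x. - dec G x) xs) > 0"
proof -
  have "map (\<lambda>x. - dec G x) xs \<noteq> []" using legD(1)[OF assms(1)] by simp
  moreover have *: "\<forall>b\<in>set (map (\<lambda>x. - dec G x) xs). b \<ge> 2" using assms(2) by force
  ultimately show "seifert_invariant (map (\<lambda>x. - dec G x) xs)
    = (continuant (map (\<lambda>x. - dec G x) xs), continuant (tl (map (\<lambda>x. - dec G x) xs)))"
    by (rule seifert_invariant_eq_continuants)
  show "continuant (map (\<lambda>x. - dec G x) xs) > 0" by (rule continuant_pos[OF *])
qed

locale two_node_plumbing =
  fixes G :: "('v::finite) two_node_graph"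
  assumes two_node_tree: "two_node_tree G"
begin

abbreviation "ch \<equiv> chain G"

lemma negdef: "negative_definite G"
  and legs1: "bij_betw (leg1 G) {1..d1 G} {xs. is_leg G (node1 G) xs}" "d1 G \<ge> 2"
  and legs2: "bij_betw (leg2 G) {1..d2 G} {xs. is_leg G (node2 G) xs}" "d2 G \<ge> 2"
  and chain_dec: "\<forall>x\<in>set ch. dec G x \<le> -2"
  using two_node_tree by (auto simp: two_node_tree_def)

sublocale two_nodes G "node1 G" "node2 G" ch
  using two_node_tree by unfold_locales (auto simp: two_node_tree_def)

sublocale sw: two_nodes G "node2 G" "node1 G" "rev ch"
  by (rule swap)

lemma leg1: "i \<in> {1..d1 G} \<Longrightarrow> is_leg G (node1 G) (leg1 G i)"
  and leg2: "i \<in> {1..d2 G} \<Longrightarrow> is_leg G (node2 G) (leg2 G i)"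
  using legs1(1) legs2(1) by (auto simp: bij_betw_def)

lemma invariants1:
  assumes "i \<in> {1..d1 G}"
  shows "\<alpha>1 G i = continuant (map (\<lambda>x. - dec G x) (leg1 G i))"
    "\<omega>1 G i = continuant (tl (map (\<lambda>x. - dec G x) (leg1 G i)))" "\<alpha>1 G i > 0"
  using leg_seifert_invariant[OF leg1[OF assms]] two_node_tree assms
  by (auto simp: \<alpha>1_def \<omega>1_def two_node_tree_def)

lemma invariants2:
  assumes "i \<in> {1..d2 G}"
  shows "\<alpha>2 G i = continuant (map (\<lambda>x. - dec G x) (leg2 G i))"
    "\<omega>2 G i = continuant (tl (map (\<lambda>x. - dec G x) (leg2 G i)))" "\<alpha>2 G i > 0"
  using sw.leg_seifert_invariant[OF leg2[OF assms]] two_node_tree assms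
  by (auto simp: \<alpha>2_def \<omega>2_def two_node_tree_def)

lemma alpha0_pos: "\<alpha>\<^sub>0 G > 0"
  unfolding \<alpha>\<^sub>0_def graph_det_chain by (rule continuant_pos) (use chain_dec in force)

lemma omega0_inverse: "\<alpha>\<^sub>0 G dvd \<omega>1\<^sub>0 G * \<omega>2\<^sub>0 G - 1"
  unfolding \<alpha>\<^sub>0_def \<omega>1\<^sub>0_def \<omega>2\<^sub>0_def graph_det_chain
  by (rule continuant_dvd) (use chain_nonempty in simp)

lemma end1_eq_iff:
  assumes "i \<in> {1..d1 G}" "j \<in> {1..d1 G}"
  shows "last (leg1 G i) = last (leg1 G j) \<longleftrightarrow> i = j"
proof
  assume "last (leg1 G i) = last (leg1 G j)"
  then have "set (leg1 G i) \<inter> set (leg1 G j) \<noteq> {}"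
    using legD(1)[OF leg1] assms by (metis disjoint_iff last_in_set)
  then have "leg1 G i = leg1 G j" using leg_eq leg1 assms by blast
  then show "i = j" by (rule inj_onD[OF bij_betw_imp_inj_on[OF legs1(1)] _ assms])
qed simp

lemma end2_eq_iff:
  assumes "i \<in> {1..d2 G}" "j \<in> {1..d2 G}"
  shows "last (leg2 G i) = last (leg2 G j) \<longleftrightarrow> i = j"
proof
  assume "last (leg2 G i) = last (leg2 G j)"
  then have "set (leg2 G i) \<inter> set (leg2 G j) \<noteq> {}"
    using sw.legD(1)[OF leg2] assms by (metis disjoint_iff last_in_set)
  then have "leg2 G i = leg2 G j" using sw.leg_eq leg2 assms by blast
  then show "i = j" by (rule inj_onD[OF bij_betw_imp_inj_on[OF legs2(1)] _ assms])
qed simp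

lemma end1_neq_end2:
  assumes "i \<in> {1..d1 G}" "j \<in> {1..d2 G}"
  shows "last (leg1 G i) \<noteq> last (leg2 G j)"
  using legs_of_both_nodes_disjoint[OF leg1 leg2] legD(1)[OF leg1] sw.legD(1)[OF leg2] assms
  by (metis disjoint_iff last_in_set)

lemma end_valency:
  "i \<in> {1..d1 G} \<Longrightarrow> valency G (last (leg1 G i)) = 1"
  "j \<in> {1..d2 G} \<Longrightarrow> valency G (last (leg2 G j)) = 1"
  using legD(4)[OF leg1] sw.legD(4)[OF leg2] by auto

text \<open>The coordinates of a lift element with respect to the dual basis.\<close>

definition lift_coeff :: "lift_vector \<Rightarrow> 'v \<Rightarrow> int" where
  "lift_coeff m u = (if u = node1 G then c1\<^sub>0 m else 0) + (if u = node2 G then c2\<^sub>0 m else 0)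
     + (if u = hd ch then cbar m else 0)
     + (\<Sum>i=1..d1 G. if u = last (leg1 G i) then c1 m i else 0)
     + (\<Sum>j=1..d2 G. if u = last (leg2 G j) then c2 m j else 0)"

lemma form_lift: "form G (lift_element G m) (E_base u) = - of_int (lift_coeff m u)"
proof -
  have if_swap: "(if a = u then - 1 else 0) = - of_int (if u = a then 1 else 0)" for a :: 'v
    by simp
  show ?thesis
    unfolding lift_element_def form_add form_scale form_sum form_E_dual[OF negdef] if_swap
    by (simp add: lift_coeff_def sum_negf if_distrib[of "\<lambda>t. _ * t"] if_distrib[of of_int] cong: if_cong)
qed

lemma lift_coeff_inner:
  assumes "valency G u \<noteq> 1"
  shows "lift_coeff m u = (if u = node1 G then c1\<^sub>0 m else 0) + (if u = node2 G then c2\<^sub>0 m else 0)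
     + (if u = hd ch then cbar m else 0)"
proof -
  have "(\<Sum>i=1..d1 G. if u = last (leg1 G i) then c1 m i else 0) = 0"
    "(\<Sum>j=1..d2 G. if u = last (leg2 G j) then c2 m j else 0) = 0"
    using assms end_valency by (auto intro!: sum.neutral)
  then show ?thesis by (simp add: lift_coeff_def)
qed

lemma hd_chain_valency: "valency G (hd ch) = 2"
  using chain_valency chain_nonempty by simp

lemma lift_coeff_nodes:
  "lift_coeff m (node1 G) = c1\<^sub>0 m" "lift_coeff m (node2 G) = c2\<^sub>0 m"
proof -
  have "valency G (node1 G) \<ge> 3" "valency G (node2 G) \<ge> 3" by (rule node_valency)+
  then have "valency G (node1 G) \<noteq> 1" "valency G (node2 G) \<noteq> 1"
    "node1 G \<noteq> hd ch" "node2 G \<noteq> hd ch" using hd_chain_valency by auto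
  then show "lift_coeff m (node1 G) = c1\<^sub>0 m" "lift_coeff m (node2 G) = c2\<^sub>0 m"
    using nodes_ne by (simp_all add: lift_coeff_inner)
qed

lemma lift_coeff_valency_2:
  assumes "valency G u = 2"
  shows "lift_coeff m u = (if u = hd ch then cbar m else 0)"
proof -
  have "u \<noteq> node1 G" "u \<noteq> node2 G" using assms node_valency by auto
  then show ?thesis using assms by (simp add: lift_coeff_inner)
qed

lemma lift_coeff_ends:
  "i \<in> {1..d1 G} \<Longrightarrow> lift_coeff m (last (leg1 G i)) = c1 m i"
  "j \<in> {1..d2 G} \<Longrightarrow> lift_coeff m (last (leg2 G j)) = c2 m j"
proof -
  have ne: "x \<noteq> node1 G" "x \<noteq> node2 G" "x \<noteq> hd ch" if "valency G x = 1" for x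
    using that node_valency hd_chain_valency by auto
  show "lift_coeff m (last (leg1 G i)) = c1 m i" if i: "i \<in> {1..d1 G}"
  proof -
    have "(\<Sum>k=1..d1 G. if last (leg1 G i) = last (leg1 G k) then c1 m k else 0)
        = (\<Sum>k=1..d1 G. if i = k then c1 m k else 0)"
      by (rule sum.cong) (use end1_eq_iff[OF i] in auto)
    moreover have "(\<Sum>j=1..d2 G. if last (leg1 G i) = last (leg2 G j) then c2 m j else 0) = 0"
      by (rule sum.neutral) (use end1_neq_end2[OF i] in auto)
    ultimately show ?thesis
      using ne[OF end_valency(1)[OF i]] i by (simp add: lift_coeff_def)
  qed
  show "lift_coeff m (last (leg2 G j)) = c2 m j" if j: "j \<in> {1..d2 G}"
  proof -
    have "(\<Sum>k=1..d2 G. if last (leg2 G j) = last (leg2 G k) then c2 m k else 0)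
        = (\<Sum>k=1..d2 G. if j = k then c2 m k else 0)"
      by (rule sum.cong) (use end2_eq_iff[OF j] in auto)
    moreover have "(\<Sum>i=1..d1 G. if last (leg2 G j) = last (leg1 G i) then c1 m i else 0) = 0"
      by (rule sum.neutral) (use end1_neq_end2[OF _ j] in force)
    ultimately show ?thesis
      using ne[OF end_valency(2)[OF j]] j by (simp add: lift_coeff_def)
  qed
qed

lemma lift_leg1:
  fixes m
  assumes i: "i \<in> {1..d1 G}"
  defines "x \<equiv> lift_element G m"
  shows "of_int (\<alpha>1 G i) * x (hd (leg1 G i)) - of_int (\<omega>1 G i) * x (node1 G) = of_int (c1 m i)"
    and "x (node1 G) \<in> \<int> \<Longrightarrow> x (hd (leg1 G i)) \<in> \<int> \<Longrightarrow> u \<in> set (leg1 G i) \<Longrightarrow> x u \<in> \<int>"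
proof -
  note leg = leg1[OF i]
  have inner: "form G x (E_base u) = 0" if u: "u \<in> set (butlast (leg1 G i))" for u
  proof -
    have "u \<noteq> hd ch" using leg_disjoint_chain[OF leg] in_set_butlastD[OF u] chain_nonempty by force
    then show ?thesis using legD(3)[OF leg u] by (simp add: x_def form_lift lift_coeff_valency_2)
  qed
  have last: "form G x (E_base (last (leg1 G i))) = - of_int (c1 m i)"
    using i by (simp add: x_def form_lift lift_coeff_ends)
  show "of_int (\<alpha>1 G i) * x (hd (leg1 G i)) - of_int (\<omega>1 G i) * x (node1 G) = of_int (c1 m i)"
    using leg_relation(1)[OF leg inner last] invariants1[OF i] by simp
  show "x (node1 G) \<in> \<int> \<Longrightarrow> x (hd (leg1 G i)) \<in> \<int> \<Longrightarrow> u \<in> set (leg1 G i) \<Longrightarrow> x u \<in> \<int>"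
    by (rule leg_relation(2)[OF leg inner last])
qed

lemma lift_leg2:
  fixes m
  assumes i: "i \<in> {1..d2 G}"
  defines "x \<equiv> lift_element G m"
  shows "of_int (\<alpha>2 G i) * x (hd (leg2 G i)) - of_int (\<omega>2 G i) * x (node2 G) = of_int (c2 m i)"
    and "x (node2 G) \<in> \<int> \<Longrightarrow> x (hd (leg2 G i)) \<in> \<int> \<Longrightarrow> u \<in> set (leg2 G i) \<Longrightarrow> x u \<in> \<int>"
proof -
  note leg = leg2[OF i]
  have inner: "form G x (E_base u) = 0" if u: "u \<in> set (butlast (leg2 G i))" for u
  proof -
    have "u \<noteq> hd ch" using sw.leg_disjoint_chain[OF leg] in_set_butlastD[OF u] chain_nonempty by force
    then show ?thesis using sw.legD(3)[OF leg u] by (simp add: x_def form_lift lift_coeff_valency_2)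
  qed
  have last: "form G x (E_base (last (leg2 G i))) = - of_int (c2 m i)"
    using i by (simp add: x_def form_lift lift_coeff_ends)
  show "of_int (\<alpha>2 G i) * x (hd (leg2 G i)) - of_int (\<omega>2 G i) * x (node2 G) = of_int (c2 m i)"
    using sw.leg_relation(1)[OF leg inner last] invariants2[OF i] by simp
  show "x (node2 G) \<in> \<int> \<Longrightarrow> x (hd (leg2 G i)) \<in> \<int> \<Longrightarrow> u \<in> set (leg2 G i) \<Longrightarrow> x u \<in> \<int>"
    by (rule sw.leg_relation(2)[OF leg inner last])
qed

lemma lift_chain:
  fixes m
  defines "x \<equiv> lift_element G m"
  shows "of_int (\<alpha>\<^sub>0 G) * x (hd ch) - of_int (\<omega>1\<^sub>0 G) * (x (node1 G) + of_int (cbar m)) = x (node2 G)"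
    and "of_int (\<alpha>\<^sub>0 G) * x (last ch) - of_int (\<omega>2\<^sub>0 G) * x (node2 G) = x (node1 G) + of_int (cbar m)"
    and "x (node2 G) \<in> \<int> \<Longrightarrow> x (last ch) \<in> \<int> \<Longrightarrow> u \<in> set ch \<Longrightarrow> x u \<in> \<int>"
proof -
  have rel: "form G x (E_base u) = - (if u = hd ch then of_int (cbar m) else 0)"
    if "u \<in> set ch" for u
    using chain_valency[OF that] by (simp add: x_def form_lift lift_coeff_valency_2)
  have forward: "form G x (E_base u)
      = - (if u = hd ch then of_int (cbar m) else 0) - (if u = last ch then 0 else 0)"
    if "u \<in> set ch" for u
    using rel[OF that] by simp
  show "of_int (\<alpha>\<^sub>0 G) * x (hd ch) - of_int (\<omega>1\<^sub>0 G) * (x (node1 G) + of_int (cbar m)) = x (node2 G)"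
    using chain_relation(1)[OF forward] by (simp add: \<alpha>\<^sub>0_def \<omega>1\<^sub>0_def graph_det_chain)
  have backward: "form G x (E_base u)
      = - (if u = hd (rev ch) then 0 else 0) - (if u = last (rev ch) then of_int (cbar m) else 0)"
    if "u \<in> set (rev ch)" for u
    using rel[of u] that by (simp add: last_rev)
  have "tl (map (\<lambda>u. - dec G u) (rev ch)) = rev (butlast (map (\<lambda>u. - dec G u) ch))"
    by (simp add: rev_map[symmetric] butlast_rev[of "rev _", simplified])
  then show "of_int (\<alpha>\<^sub>0 G) * x (last ch) - of_int (\<omega>2\<^sub>0 G) * x (node2 G) = x (node1 G) + of_int (cbar m)"
    using sw.chain_relation(1)[OF backward]
    by (simp add: \<alpha>\<^sub>0_def \<omega>2\<^sub>0_def graph_det_chain continuant_rev rev_map[symmetric] hd_rev)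
  show "x (node2 G) \<in> \<int> \<Longrightarrow> x (last ch) \<in> \<int> \<Longrightarrow> u \<in> set ch \<Longrightarrow> x u \<in> \<int>"
    using sw.chain_relation(2)[OF backward] by (simp add: hd_rev)
qed

lemma lift_node1:
  "of_int (dec G (node1 G)) * lift_element G m (node1 G) + lift_element G m (hd ch)
    + (\<Sum>i=1..d1 G. lift_element G m (hd (leg1 G i))) = - of_int (c1\<^sub>0 m)"
  using node_relation(1)[OF legs1(1), of "lift_element G m"]
  by (simp add: form_lift lift_coeff_nodes)

lemma lift_node2:
  "of_int (dec G (node2 G)) * lift_element G m (node2 G) + lift_element G m (last ch)
    + (\<Sum>j=1..d2 G. lift_element G m (hd (leg2 G j))) = - of_int (c2\<^sub>0 m)"
  using sw.node_relation(1)[OF legs2(1), of "lift_element G m"]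
  by (simp add: form_lift lift_coeff_nodes hd_rev)

text \<open>Solving the relations on the legs and on the chain for the neighbours of the nodes and inserting the
result into the equations at the nodes eliminates all coordinates but those at the nodes.\<close>

lemma orb_equations:
  fixes m
  defines "u \<equiv> lift_element G m (node1 G)" and "w \<equiv> lift_element G m (node2 G)"
  shows "e1 G * u + w / of_int (\<alpha>\<^sub>0 G) = - A1 G m" "u / of_int (\<alpha>\<^sub>0 G) + e2 G * w = - A2 G m"
proof -
  let ?x = "lift_element G m"
  have a0: "(of_int (\<alpha>\<^sub>0 G) :: rat) \<noteq> 0" using alpha0_pos by simp
  have "?x (hd (leg1 G i)) = of_int (\<omega>1 G i) / of_int (\<alpha>1 G i) * u + of_int (c1 m i) / of_int (\<alpha>1 G i)"
    if "i \<in> {1..d1 G}" for i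
    using lift_leg1(1)[OF that, of m] invariants1(3)[OF that] by (simp add: u_def field_simps)
  then have s: "(\<Sum>i=1..d1 G. ?x (hd (leg1 G i))) = (\<Sum>i=1..d1 G. of_int (\<omega>1 G i) / of_int (\<alpha>1 G i)) * u
      + (\<Sum>i=1..d1 G. of_int (c1 m i) / of_int (\<alpha>1 G i))"
    by (simp add: sum.distrib sum_distrib_right)
  have h: "?x (hd ch) = of_int (\<omega>1\<^sub>0 G) / of_int (\<alpha>\<^sub>0 G) * (u + of_int (cbar m)) + w / of_int (\<alpha>\<^sub>0 G)"
    using lift_chain(1)[of m] a0 by (simp add: u_def w_def field_simps)
  show "e1 G * u + w / of_int (\<alpha>\<^sub>0 G) = - A1 G m"
    using lift_node1[of m] unfolding s h e1_def A1_def u_def[symmetric]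
    by (simp add: algebra_simps add_divide_distrib)
  have "?x (hd (leg2 G i)) = of_int (\<omega>2 G i) / of_int (\<alpha>2 G i) * w + of_int (c2 m i) / of_int (\<alpha>2 G i)"
    if "i \<in> {1..d2 G}" for i
    using lift_leg2(1)[OF that, of m] invariants2(3)[OF that] by (simp add: w_def field_simps)
  then have s: "(\<Sum>i=1..d2 G. ?x (hd (leg2 G i))) = (\<Sum>i=1..d2 G. of_int (\<omega>2 G i) / of_int (\<alpha>2 G i)) * w
      + (\<Sum>i=1..d2 G. of_int (c2 m i) / of_int (\<alpha>2 G i))"
    by (simp add: sum.distrib sum_distrib_right)
  have h: "?x (last ch) = of_int (\<omega>2\<^sub>0 G) / of_int (\<alpha>\<^sub>0 G) * w + (u + of_int (cbar m)) / of_int (\<alpha>\<^sub>0 G)"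
    using lift_chain(2)[of m] a0 by (simp add: u_def w_def field_simps)
  show "u / of_int (\<alpha>\<^sub>0 G) + e2 G * w = - A2 G m"
    using lift_node2[of m] unfolding s h e2_def A2_def w_def[symmetric]
    by (simp add: algebra_simps add_divide_distrib)
qed

text \<open>The node coordinates of the dual basis elements of the two nodes, read off from \<open>orb_equations\<close>, form
the columns of a right inverse of minus the orbifold matrix.\<close>

lemma orb_det_nonzero: "e1 G * e2 G - 1 / of_int (\<alpha>\<^sub>0 G) * (1 / of_int (\<alpha>\<^sub>0 G)) \<noteq> 0"
proof -
  let ?a = "1 / of_int (\<alpha>\<^sub>0 G) :: rat"
  define m where "m s t = \<lparr>c1\<^sub>0 = s, c2\<^sub>0 = t, cbar = 0, c1 = \<lambda>_. 0, c2 = \<lambda>_. 0\<rparr>" for s t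
  have A: "A1 G (m s t) = of_int s" "A2 G (m s t) = of_int t" for s t
    by (simp_all add: m_def A1_def A2_def)
  obtain p1 p2 where p: "e1 G * p1 + p2 * ?a = -1" "p1 * ?a + e2 G * p2 = 0"
    using orb_equations[of "m 1 0"] by (auto simp: A)
  obtain q1 q2 where q: "e1 G * q1 + q2 * ?a = 0" "q1 * ?a + e2 G * q2 = -1"
    using orb_equations[of "m 0 1"] by (auto simp: A)
  have "(e1 G * e2 G - ?a * ?a) * (p1 * q2 - p2 * q1)
      = (e1 G * p1 + p2 * ?a) * (q1 * ?a + e2 G * q2) - (e1 G * q1 + q2 * ?a) * (p1 * ?a + e2 G * p2)"
    by (simp only: algebra_simps)
  also have "\<dots> = 1" unfolding p q by simp
  finally show ?thesis by auto
qed

lemma orb_injective: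
  assumes "e1 G * u + w / of_int (\<alpha>\<^sub>0 G) = e1 G * u' + w' / of_int (\<alpha>\<^sub>0 G)"
    "u / of_int (\<alpha>\<^sub>0 G) + e2 G * w = u' / of_int (\<alpha>\<^sub>0 G) + e2 G * w'"
  shows "u = u' \<and> w = w'"
proof -
  let ?a = "1 / of_int (\<alpha>\<^sub>0 G) :: rat"
  define s t where "s = u - u'" and "t = w - w'"
  have 1: "e1 G * s + ?a * t = 0" and 2: "?a * s + e2 G * t = 0"
    using assms by (simp_all add: s_def t_def algebra_simps diff_divide_distrib)
  \<comment> \<open>Multiplication by the adjugate matrix.\<close>
  have "(e1 G * e2 G - ?a * ?a) * s = e2 G * (e1 G * s + ?a * t) - ?a * (?a * s + e2 G * t)"
    "(e1 G * e2 G - ?a * ?a) * t = e1 G * (?a * s + e2 G * t) - ?a * (e1 G * s + ?a * t)"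
    by (simp_all only: algebra_simps)
  then have "s = 0" "t = 0" using orb_det_nonzero unfolding 1 2 by simp_all
  then show ?thesis by (simp add: s_def t_def)
qed

lemma node_coeffs_eq:
  "node_coeffs G m $ 0 = lift_element G m (node1 G)"
  "node_coeffs G m $ 1 = lift_element G m (node2 G)"
proof -
  let ?M = "- I_orb G"
  let ?x = "vec_of_list [lift_element G m (node1 G), lift_element G m (node2 G)]"
  define a :: rat where "a = 1 / of_int (\<alpha>\<^sub>0 G)"
  define D where "D = e1 G * e2 G - a * a"
  \<comment> \<open>The adjugate matrix divided by the determinant: it certifies that \<open>mat_inverse\<close> is defined.\<close>
  let ?R = "mat_of_rows_list 2 [[- e2 G / D, a / D], [a / D, - e1 G / D]]"
  have I: "I_orb G = mat_of_rows_list 2 [[e1 G, a], [a, e2 G]]" by (simp add: I_orb_def a_def)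
  have M: "?M \<in> carrier_mat 2 2" by (auto simp: I_orb_def mat_of_rows_list_def)
  have R: "?R \<in> carrier_mat 2 2" by (auto simp: mat_of_rows_list_def)
  have "D \<noteq> 0" using orb_det_nonzero by (simp add: D_def a_def)
  then have D: "e1 G * e2 G / D - a * a / D = 1" "e2 G * e1 G / D - a * a / D = 1"
    by (simp_all add: diff_divide_distrib[symmetric] D_def mult.commute)
  have MR: "?M * ?R = 1\<^sub>m 2"
  proof (rule eq_matI)
    fix i j assume "i < dim_row (1\<^sub>m 2 :: rat mat)" "j < dim_col (1\<^sub>m 2 :: rat mat)"
    then have "i = 0 \<or> i = 1" "j = 0 \<or> j = 1" by auto
    then show "(?M * ?R) $$ (i, j) = 1\<^sub>m 2 $$ (i, j)"
      using D by (auto simp: I mat_of_rows_list_def scalar_prod_def numeral_2_eq_2)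
  qed (auto simp: I_orb_def mat_of_rows_list_def)
  have RM: "?R * ?M = 1\<^sub>m 2" by (rule mat_mult_left_right_inverse[OF M R MR])
  have "?M \<in> Units (ring_mat TYPE(rat) 2 ())"
    using M R MR RM by (auto simp: Units_def ring_mat_def)
  then obtain B where B: "mat_inverse ?M = Some B"
    using mat_inverse(1)[OF M, of "()"] by (cases "mat_inverse ?M") auto
  have BM: "B * ?M = 1\<^sub>m 2" and Bc: "B \<in> carrier_mat 2 2" using mat_inverse(2)[OF M B] by auto
  have x: "?x \<in> carrier_vec 2" by (rule carrier_vecI) (simp only: dim_vec_of_list list.size numeral_2_eq_2 add_0 add_Suc_right add_0_right One_nat_def)
  have "?M *\<^sub>v ?x = vec_of_list [A1 G m, A2 G m]"
  proof (rule eq_vecI)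
    fix i assume "i < dim_vec (vec_of_list [A1 G m, A2 G m])"
    then have "i = 0 \<or> i = 1" by auto
    then show "(?M *\<^sub>v ?x) $ i = vec_of_list [A1 G m, A2 G m] $ i"
      using orb_equations[of m]
      by (auto simp: I_orb_def mat_of_rows_list_def scalar_prod_def numeral_2_eq_2)
  qed (auto simp: I_orb_def mat_of_rows_list_def)
  then have "node_coeffs G m = B *\<^sub>v (?M *\<^sub>v ?x)" by (simp add: node_coeffs_def B)
  also have "\<dots> = (B * ?M) *\<^sub>v ?x" by (rule assoc_mult_mat_vec[symmetric, OF Bc M x])
  also have "\<dots> = ?x" using x by (simp add: BM)
  finally have "node_coeffs G m = ?x" .
  then show "node_coeffs G m $ 0 = lift_element G m (node1 G)"
    "node_coeffs G m $ 1 = lift_element G m (node2 G)" by simp_all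
qed

end


lemma Ints_iff_dvd:
  fixes r :: rat and a s :: int
  assumes "a > 0" "of_int a * r = of_int s"
  shows "r \<in> \<int> \<longleftrightarrow> a dvd s"
proof
  assume "r \<in> \<int>"
  then obtain k where "r = of_int k" by (auto elim: Ints_cases)
  then have "of_int (a * k) = (of_int s :: rat)" using assms(2) by simp
  then have "a * k = s" by (simp only: of_int_eq_iff)
  then show "a dvd s" by auto
next
  assume "a dvd s"
  then obtain k where "s = a * k" by blast
  then have "r = of_int k" using assms by simp
  then show "r \<in> \<int>" by simp
qed

lemma of_int_div_eq: "a dvd b \<Longrightarrow> (of_int (b div a) :: rat) = of_int b / of_int a"
  by (cases "a = 0") auto

context two_node_plumbing
begin

lemma leg1_index:
  assumes "is_leg G (node1 G) xs"
  obtains i where "i \<in> {1..d1 G}" "xs = leg1 G i"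
  using assms bij_betw_imp_surj_on[OF legs1(1)] by (metis imageE mem_Collect_eq)

lemma leg2_index:
  assumes "is_leg G (node2 G) xs"
  obtains j where "j \<in> {1..d2 G}" "xs = leg2 G j"
  using assms bij_betw_imp_surj_on[OF legs2(1)] by (metis imageE mem_Collect_eq)

lemma lift_in_dual_lattice: "lift_element G m \<in> dual_lattice G"
  by (rule dual_latticeI) (simp add: form_lift)

text \<open>\<open>lift_element\<close> is linear in the lift vector, so the difference of two lifts is described by a lift
vector again and satisfies the same linear relations.\<close>

definition lift_diff :: "lift_vector \<Rightarrow> lift_vector \<Rightarrow> lift_vector" where
  "lift_diff m m' = \<lparr>c1\<^sub>0 = c1\<^sub>0 m - c1\<^sub>0 m', c2\<^sub>0 = c2\<^sub>0 m - c2\<^sub>0 m', cbar = cbar m - cbar m',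
     c1 = (\<lambda>i. c1 m i - c1 m' i), c2 = (\<lambda>j. c2 m j - c2 m' j)\<rparr>"

lemma lift_element_diff:
  "lift_element G (lift_diff m m') = (\<lambda>v. lift_element G m v - lift_element G m' v)"
  by (rule ext) (simp add: lift_element_def lift_diff_def sum_subtractf algebra_simps)

text \<open>By the recurrences, a vector with integral node coordinates is integral as soon as it is integral at
the first vertex of each leg and at one end of the chain, and there its coordinates are explicit
fractions with denominators \<open>\<alpha>1 G i\<close>, \<open>\<alpha>2 G j\<close> and \<open>\<alpha>\<^sub>0 G\<close>.\<close>

lemma int_lattice_iff:
  assumes l1: "lift_element G m (node1 G) = of_int l1" and l2: "lift_element G m (node2 G) = of_int l2"
  shows "lift_element G m \<in> int_lattice \<longleftrightarrow>
    (\<forall>i\<in>{1..d1 G}. \<alpha>1 G i dvd c1 m i + \<omega>1 G i * l1)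
    \<and> (\<forall>j\<in>{1..d2 G}. \<alpha>2 G j dvd c2 m j + \<omega>2 G j * l2)
    \<and> \<alpha>\<^sub>0 G dvd l1 + \<omega>2\<^sub>0 G * l2 + cbar m" (is "?L \<longleftrightarrow> ?R")
proof -
  let ?x = "lift_element G m"
  have 1: "?x (hd (leg1 G i)) \<in> \<int> \<longleftrightarrow> \<alpha>1 G i dvd c1 m i + \<omega>1 G i * l1" if "i \<in> {1..d1 G}" for i
    by (rule Ints_iff_dvd[OF invariants1(3)[OF that]])
      (use lift_leg1(1)[OF that, of m] l1 in \<open>simp add: algebra_simps\<close>)
  have 2: "?x (hd (leg2 G j)) \<in> \<int> \<longleftrightarrow> \<alpha>2 G j dvd c2 m j + \<omega>2 G j * l2" if "j \<in> {1..d2 G}" for j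
    by (rule Ints_iff_dvd[OF invariants2(3)[OF that]])
      (use lift_leg2(1)[OF that, of m] l2 in \<open>simp add: algebra_simps\<close>)
  have 3: "?x (last ch) \<in> \<int> \<longleftrightarrow> \<alpha>\<^sub>0 G dvd l1 + \<omega>2\<^sub>0 G * l2 + cbar m"
    by (rule Ints_iff_dvd[OF alpha0_pos])
      (use lift_chain(2)[of m] l1 l2 in \<open>simp add: algebra_simps\<close>)
  show ?thesis
  proof
    assume ?L
    then have "?x u \<in> \<int>" for u by (simp add: int_lattice_def)
    then show ?R using 1 2 3 by blast
  next
    assume R: ?R
    have "?x u \<in> \<int>" for u
    proof (rule vertex_cases[of u])
      show "?x u \<in> \<int>" if "u = node1 G" using that l1 by simp
      show "?x u \<in> \<int>" if "u = node2 G" using that l2 by simp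
      show "?x u \<in> \<int>" if "u \<in> set ch"
        by (rule lift_chain(3)[OF _ _ that]) (use l2 3 R in auto)
      show "?x u \<in> \<int>" if leg: "is_leg G (node1 G) xs" and u: "u \<in> set xs" for xs
      proof -
        obtain i where i: "i \<in> {1..d1 G}" "xs = leg1 G i" by (rule leg1_index[OF leg])
        show ?thesis by (rule lift_leg1(2)[OF i(1)]) (use l1 1[OF i(1)] R i u in auto)
      qed
      show "?x u \<in> \<int>" if leg: "is_leg G (node2 G) xs" and u: "u \<in> set xs" for xs
      proof -
        obtain i where i: "i \<in> {1..d2 G}" "xs = leg2 G i" by (rule leg2_index[OF leg])
        show ?thesis by (rule lift_leg2(2)[OF i(1)]) (use l2 2[OF i(1)] R i u in auto)
      qed
    qed
    then show ?L by (simp add: int_lattice_def)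
  qed
qed

section \<open>The support of the series\<close>

text \<open>The exponents of the monomials of \<open>Z\<close> as lift elements: they are supported on the nodes and the ends of
the legs, so the component on the chain vanishes.\<close>

definition exponent_lift :: "nat \<Rightarrow> (nat \<Rightarrow> nat) \<Rightarrow> nat \<Rightarrow> (nat \<Rightarrow> nat) \<Rightarrow> lift_vector" where
  "exponent_lift k y k' y' =
     \<lparr>c1\<^sub>0 = int k, c2\<^sub>0 = int k', cbar = 0, c1 = (\<lambda>i. int (y i)), c2 = (\<lambda>j. int (y' j))\<rparr>"

definition vertex_factor :: "'v \<Rightarrow> nat \<Rightarrow> rat" where
  "vertex_factor v n = fps_nth ((1 - fps_X :: rat fps) powi (int (valency G v) - 2)) n"

lemma vertex_factor_end: "valency G v = 1 \<Longrightarrow> vertex_factor v n = 1"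
  by (simp add: vertex_factor_def power_int_def nth_one_minus_X_inverse)

lemma vertex_factor_inner: "valency G v = 2 \<Longrightarrow> vertex_factor v n = (if n = 0 then 1 else 0)"
  by (simp add: vertex_factor_def)

lemma vertex_factor_nodes:
  "vertex_factor (node1 G) n = fps_nth ((1 - fps_X) ^ (d1 G - 1)) n"
  "vertex_factor (node2 G) n = fps_nth ((1 - fps_X) ^ (d2 G - 1)) n"
proof -
  have e: "int (d + 1) - 2 = int (d - 1)" if "d \<ge> 2" for d using that by simp
  show "vertex_factor (node1 G) n = fps_nth ((1 - fps_X) ^ (d1 G - 1)) n"
    unfolding vertex_factor_def node_relation(2)[OF legs1(1)] e[OF legs1(2)] power_int_of_nat ..
  show "vertex_factor (node2 G) n = fps_nth ((1 - fps_X) ^ (d2 G - 1)) n"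
    unfolding vertex_factor_def sw.node_relation(2)[OF legs2(1)] e[OF legs2(2)] power_int_of_nat ..
qed

lemma valency_cases:
  obtains "v = node1 G" | "v = node2 G" | "valency G v = 2"
    | i where "i \<in> {1..d1 G}" "v = last (leg1 G i)"
    | j where "j \<in> {1..d2 G}" "v = last (leg2 G j)"
proof -
  have inner_or_last: "u \<in> set (butlast xs) \<or> u = last xs" if "u \<in> set xs" for u :: 'v and xs
  proof -
    have "set (butlast xs @ [last xs]) = set xs" using that by (subst append_butlast_last_id) auto
    then show ?thesis using that by auto
  qed
  consider "v = node1 G" | "v = node2 G" | "v \<in> set ch"
    | xs where "is_leg G (node1 G) xs" "v \<in> set xs" | xs where "is_leg G (node2 G) xs" "v \<in> set xs"
    by (rule vertex_cases[of v])
  then show thesis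
  proof cases
    case (4 xs)
    obtain i where "i \<in> {1..d1 G}" "xs = leg1 G i" by (rule leg1_index[OF 4(1)])
    then show thesis using inner_or_last[OF 4(2)] legD(3)[OF 4(1)] that(3,4) by metis
  next
    case (5 xs)
    obtain j where "j \<in> {1..d2 G}" "xs = leg2 G j" by (rule leg2_index[OF 5(1)])
    then show thesis using inner_or_last[OF 5(2)] sw.legD(3)[OF 5(1)] that(3,5) by metis
  qed (use that chain_valency in simp_all)
qed

lemma form_dual_expansion:
  "form G (\<lambda>w. \<Sum>v\<in>UNIV. of_nat (n v) * E_dual G v w) (E_base u) = - of_nat (n u)"
proof -
  have "form G (\<lambda>w. \<Sum>v\<in>UNIV. of_nat (n v) * E_dual G v w) (E_base u)
      = (\<Sum>v\<in>UNIV. of_nat (n v) * (if v = u then -1 else 0))"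
    unfolding form_sum form_scale form_E_dual[OF negdef] ..
  then show ?thesis by (simp add: if_distrib[of "\<lambda>t. _ * t"] cong: if_cong)
qed

text \<open>Pairing with the basis vectors recovers the coefficients of \<open>x\<close> in the dual basis, so the defining
sum has exactly one term.\<close>

lemma Z_coeff_eq_prod:
  assumes "\<And>v. form G x (E_base v) = - of_nat (n v)"
  shows "Z_coeff G x = (\<Prod>v\<in>UNIV. vertex_factor v (n v))"
proof -
  let ?F = "\<lambda>n w. \<Sum>v\<in>UNIV. of_nat (n v) * E_dual G v w"
  have "{n'. ?F n' = x} = {n}"
  proof
    show "{n'. ?F n' = x} \<subseteq> {n}"
    proof
      fix n' assume "n' \<in> {n'. ?F n' = x}"
      then have x: "?F n' = x" by (rule CollectD)
      have "n' u = n u" for u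
        using form_dual_expansion[of n' u] assms[of u] unfolding x by simp
      then have "n' = n" by (rule ext)
      then show "n' \<in> {n}" by (rule ssubst) (rule singletonI)
    qed
    have "?F n = x" by (rule form_eqI[OF negdef]) (simp add: form_dual_expansion assms)
    then show "{n} \<subseteq> {n'. ?F n' = x}" by blast
  qed
  then show ?thesis by (simp add: Z_coeff_def vertex_factor_def)
qed

lemma Z_coeff_exponent_lift:
  "Z_coeff G (lift_element G (exponent_lift k y k' y'))
    = fps_nth ((1 - fps_X) ^ (d1 G - 1)) k * fps_nth ((1 - fps_X) ^ (d2 G - 1)) k'"
proof -
  let ?m = "exponent_lift k y k' y'"
  define n where "n v = nat (lift_coeff ?m v)" for v
  have "lift_coeff ?m v \<ge> 0" for v
    by (auto simp: lift_coeff_def exponent_lift_def intro!: add_nonneg_nonneg sum_nonneg)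
  then have n: "lift_coeff ?m v = int (n v)" for v by (simp add: n_def)
  have "Z_coeff G (lift_element G ?m) = (\<Prod>v\<in>UNIV. vertex_factor v (n v))"
    by (rule Z_coeff_eq_prod) (simp add: form_lift n)
  also have "\<dots> = (\<Prod>v\<in>{node1 G, node2 G}. vertex_factor v (n v))"
  proof (rule prod.mono_neutral_right)
    show "\<forall>v\<in>UNIV - {node1 G, node2 G}. vertex_factor v (n v) = 1"
    proof
      fix v assume v: "v \<in> UNIV - {node1 G, node2 G}"
      show "vertex_factor v (n v) = 1"
      proof (rule valency_cases[of v])
        assume v2: "valency G v = 2"
        then have "n v = 0" using n[of v] by (simp add: lift_coeff_valency_2 exponent_lift_def split: if_splits)
        then show ?thesis using v2 by (simp add: vertex_factor_inner)
      qed (use v end_valency vertex_factor_end in auto)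
    qed
  qed auto
  also have "\<dots> = vertex_factor (node1 G) k * vertex_factor (node2 G) k'"
    using nodes_ne n[of "node1 G"] n[of "node2 G"]
    by (simp add: lift_coeff_nodes exponent_lift_def)
  finally show ?thesis by (simp add: vertex_factor_nodes)
qed

text \<open>The factor 1 of a vertex of valency 2 has no terms of positive degree, so only the nodes and the ends
of the legs occur in the exponent.\<close>

lemma Z_coeff_support:
  assumes "Z_coeff G x \<noteq> 0"
  obtains k y k' y' where "y \<in> {1..d1 G} \<rightarrow>\<^sub>E UNIV" "y' \<in> {1..d2 G} \<rightarrow>\<^sub>E UNIV"
    "x = lift_element G (exponent_lift k y k' y')"
proof -
  let ?F = "\<lambda>n w. \<Sum>v\<in>UNIV. of_nat (n v) * E_dual G v w"
  have "{n. ?F n = x} \<noteq> {}"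
  proof
    assume empty: "{n. ?F n = x} = {}"
    have "Z_coeff G x = 0" unfolding Z_coeff_def empty by simp
    then show False using assms by simp
  qed
  then obtain n where "n \<in> {n. ?F n = x}" by (meson ex_in_conv)
  then have n: "?F n = x" by (rule CollectD)
  have form: "form G x (E_base v) = - of_nat (n v)" for v
    using form_dual_expansion[of n v] unfolding n .
  have "(\<Prod>v\<in>UNIV. vertex_factor v (n v)) \<noteq> 0" using Z_coeff_eq_prod[OF form] assms by simp
  then have "vertex_factor v (n v) \<noteq> 0" for v by simp
  then have inner: "n v = 0" if "valency G v = 2" for v
    using vertex_factor_inner[OF that, of "n v"] by (metis (full_types))
  define y where "y = (\<lambda>i\<in>{1..d1 G}. n (last (leg1 G i)))"
  define y' where "y' = (\<lambda>j\<in>{1..d2 G}. n (last (leg2 G j)))"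
  let ?m = "exponent_lift (n (node1 G)) y (n (node2 G)) y'"
  have "lift_coeff ?m v = int (n v)" for v
  proof (rule valency_cases[of v])
    assume "valency G v = 2"
    then show ?thesis by (simp add: lift_coeff_valency_2 exponent_lift_def inner split: if_splits)
  qed (simp_all only: lift_coeff_nodes lift_coeff_ends, simp_all add: exponent_lift_def y_def y'_def)
  then have "x = lift_element G ?m"
    by (intro form_eqI[OF negdef]) (simp add: form form_lift)
  then show thesis using that[of y y' "n (node1 G)" "n (node2 G)"] by (simp add: y_def y'_def)
qed

lemma exponent_lift_inj:
  assumes eq: "lift_element G (exponent_lift k y k' y') = lift_element G (exponent_lift l z l' z')"
    and "y \<in> {1..d1 G} \<rightarrow>\<^sub>E UNIV" "z \<in> {1..d1 G} \<rightarrow>\<^sub>E UNIV"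
    and "y' \<in> {1..d2 G} \<rightarrow>\<^sub>E UNIV" "z' \<in> {1..d2 G} \<rightarrow>\<^sub>E UNIV"
  shows "k = l" "y = z" "k' = l'" "y' = z'"
proof -
  let ?m = "exponent_lift k y k' y'" and ?m' = "exponent_lift l z l' z'"
  have "- of_int (lift_coeff ?m v) = (- of_int (lift_coeff ?m' v) :: rat)" for v
    unfolding form_lift[symmetric] eq ..
  then have coeff: "lift_coeff ?m v = lift_coeff ?m' v" for v by simp
  show "k = l" "k' = l'"
    using coeff[of "node1 G"] coeff[of "node2 G"] by (simp_all add: lift_coeff_nodes exponent_lift_def)
  have "y i = z i" if "i \<in> {1..d1 G}" for i
    using coeff[of "last (leg1 G i)"] unfolding lift_coeff_ends(1)[OF that]
    by (simp add: exponent_lift_def)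
  then show "y = z" by (rule PiE_ext[OF assms(2,3)])
  have "y' i = z' i" if "i \<in> {1..d2 G}" for i
    using coeff[of "last (leg2 G i)"] unfolding lift_coeff_ends(2)[OF that]
    by (simp add: exponent_lift_def)
  then show "y' = z'" by (rule PiE_ext[OF assms(4,5)])
qed

end


lemma nat_plus_int_eq_iff: "(of_nat k + of_int s = (of_int b :: rat)) \<longleftrightarrow> int k + s = b"
  by (metis of_int_add of_int_eq_iff of_int_of_nat_eq)

context two_node_plumbing
begin

section \<open>Counting exponents with given node coordinates\<close>

text \<open>In the next definitions, \<open>(l1, l2)\<close> are the node coordinates of the difference between an exponent and
the lift \<open>c\<close>.  The numbers \<open>remainder1 c l1 i\<close> prescribe the exponent at the end of leg \<open>i\<close> modulo
\<open>\<alpha>1 G i\<close>, and \<open>budget1 c l1 l2\<close> is \<open>N1 G c l1 l2\<close> without its sum of floors; the division in it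
is exact under the congruence on the chain (\<open>chain_dvd\<close>).\<close>

definition remainder1 :: "lift_vector \<Rightarrow> int \<Rightarrow> nat \<Rightarrow> int" where
  "remainder1 c l1 i = c1 c i - \<omega>1 G i * l1"

definition remainder2 :: "lift_vector \<Rightarrow> int \<Rightarrow> nat \<Rightarrow> int" where
  "remainder2 c l2 j = c2 c j - \<omega>2 G j * l2"

definition budget1 :: "lift_vector \<Rightarrow> int \<Rightarrow> int \<Rightarrow> int" where
  "budget1 c l1 l2 = c1\<^sub>0 c - dec G (node1 G) * l1 - (\<omega>1\<^sub>0 G * (l1 - cbar c) + l2) div \<alpha>\<^sub>0 G"

definition budget2 :: "lift_vector \<Rightarrow> int \<Rightarrow> int \<Rightarrow> int" where
  "budget2 c l1 l2 = c2\<^sub>0 c - dec G (node2 G) * l2 - (l1 + \<omega>2\<^sub>0 G * l2 - cbar c) div \<alpha>\<^sub>0 G"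

definition exponents1 :: "lift_vector \<Rightarrow> int \<Rightarrow> int \<Rightarrow> (nat \<times> (nat \<Rightarrow> nat)) set" where
  "exponents1 c l1 l2 = {(k, y). y \<in> {1..d1 G} \<rightarrow>\<^sub>E UNIV
     \<and> (\<forall>i\<in>{1..d1 G}. \<alpha>1 G i dvd int (y i) - remainder1 c l1 i)
     \<and> int k + (\<Sum>i=1..d1 G. (int (y i) - remainder1 c l1 i) div \<alpha>1 G i) = budget1 c l1 l2}"

definition exponents2 :: "lift_vector \<Rightarrow> int \<Rightarrow> int \<Rightarrow> (nat \<times> (nat \<Rightarrow> nat)) set" where
  "exponents2 c l1 l2 = {(k, y). y \<in> {1..d2 G} \<rightarrow>\<^sub>E UNIV
     \<and> (\<forall>j\<in>{1..d2 G}. \<alpha>2 G j dvd int (y j) - remainder2 c l2 j)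
     \<and> int k + (\<Sum>j=1..d2 G. (int (y j) - remainder2 c l2 j) div \<alpha>2 G j) = budget2 c l1 l2}"

text \<open>The congruence is stated at the end of the chain next to the second node.  As \<open>\<omega>1\<^sub>0 G\<close> and \<open>\<omega>2\<^sub>0 G\<close>
are inverse modulo \<open>\<alpha>\<^sub>0 G\<close>, it implies the congruence at the other end.\<close>

lemma chain_dvd:
  assumes "\<alpha>\<^sub>0 G dvd l1 + \<omega>2\<^sub>0 G * l2 - cb"
  shows "\<alpha>\<^sub>0 G dvd \<omega>1\<^sub>0 G * (l1 - cb) + l2"
proof -
  have "\<omega>1\<^sub>0 G * (l1 - cb) + l2
      = \<omega>1\<^sub>0 G * (l1 + \<omega>2\<^sub>0 G * l2 - cb) - (\<omega>1\<^sub>0 G * \<omega>2\<^sub>0 G - 1) * l2"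
    by (simp add: algebra_simps)
  then show ?thesis using assms omega0_inverse by (simp add: dvd_diff dvd_mult dvd_mult2)
qed

lemma of_int_budget1:
  assumes "\<alpha>\<^sub>0 G dvd l1 + \<omega>2\<^sub>0 G * l2 - cbar c"
  shows "of_int (budget1 c l1 l2) = of_int (c1\<^sub>0 c) + of_int (\<omega>1\<^sub>0 G) / of_int (\<alpha>\<^sub>0 G) * of_int (cbar c)
     - (of_int (dec G (node1 G)) + of_int (\<omega>1\<^sub>0 G) / of_int (\<alpha>\<^sub>0 G)) * of_int l1
     - 1 / of_int (\<alpha>\<^sub>0 G) * (of_int l2 :: rat)"
  unfolding budget1_def of_int_diff of_int_div_eq[OF chain_dvd[OF assms]] of_int_add of_int_mult
  by (simp add: algebra_simps add_divide_distrib diff_divide_distrib)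

lemma of_int_budget2:
  assumes "\<alpha>\<^sub>0 G dvd l1 + \<omega>2\<^sub>0 G * l2 - cbar c"
  shows "of_int (budget2 c l1 l2) = of_int (c2\<^sub>0 c) + 1 / of_int (\<alpha>\<^sub>0 G) * of_int (cbar c)
     - (of_int (dec G (node2 G)) + of_int (\<omega>2\<^sub>0 G) / of_int (\<alpha>\<^sub>0 G)) * of_int l2
     - 1 / of_int (\<alpha>\<^sub>0 G) * (of_int l1 :: rat)"
  unfolding budget2_def of_int_diff of_int_div_eq[OF assms] of_int_add of_int_mult
  by (simp add: algebra_simps add_divide_distrib diff_divide_distrib)

text \<open>On each leg, the fractions with denominator \<open>\<alpha>1 G i\<close> in \<open>e1 G\<close> and in \<open>A1 G\<close> combine to the exact
quotient of the second equation.\<close>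

lemma orb_equation1_iff:
  fixes y :: "nat \<Rightarrow> nat"
  assumes dvd0: "\<alpha>\<^sub>0 G dvd l1 + \<omega>2\<^sub>0 G * l2 - cbar c"
    and dvd1: "\<And>i. i \<in> {1..d1 G} \<Longrightarrow> \<alpha>1 G i dvd int (y i) - remainder1 c l1 i"
  shows "e1 G * of_int l1 + of_int l2 / of_int (\<alpha>\<^sub>0 G) = - A1 G (lift_diff (exponent_lift k y k' y') c)
    \<longleftrightarrow> int k + (\<Sum>i=1..d1 G. (int (y i) - remainder1 c l1 i) div \<alpha>1 G i) = budget1 c l1 l2"
proof -
  let ?r = "of_int :: int \<Rightarrow> rat"
  have "?r (\<Sum>i=1..d1 G. (int (y i) - remainder1 c l1 i) div \<alpha>1 G i)
      = (\<Sum>i=1..d1 G. (of_nat (y i) - ?r (c1 c i)) / ?r (\<alpha>1 G i) + ?r (\<omega>1 G i) / ?r (\<alpha>1 G i) * ?r l1)"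
    unfolding of_int_sum
  proof (rule sum.cong[OF refl])
    fix i assume i: "i \<in> {1..d1 G}"
    show "?r ((int (y i) - remainder1 c l1 i) div \<alpha>1 G i)
        = (of_nat (y i) - ?r (c1 c i)) / ?r (\<alpha>1 G i) + ?r (\<omega>1 G i) / ?r (\<alpha>1 G i) * ?r l1"
      unfolding of_int_div_eq[OF dvd1[OF i]]
      by (simp add: remainder1_def diff_divide_distrib add_divide_distrib)
  qed
  also have "\<dots> = (\<Sum>i=1..d1 G. (of_nat (y i) - ?r (c1 c i)) / ?r (\<alpha>1 G i))
      + (\<Sum>i=1..d1 G. ?r (\<omega>1 G i) / ?r (\<alpha>1 G i)) * ?r l1"
    by (simp add: sum.distrib sum_distrib_right)
  finally have s: "?r (\<Sum>i=1..d1 G. (int (y i) - remainder1 c l1 i) div \<alpha>1 G i) = \<dots>" .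
  have "int k + (\<Sum>i=1..d1 G. (int (y i) - remainder1 c l1 i) div \<alpha>1 G i) = budget1 c l1 l2
      \<longleftrightarrow> of_nat k + ?r (\<Sum>i=1..d1 G. (int (y i) - remainder1 c l1 i) div \<alpha>1 G i) = ?r (budget1 c l1 l2)"
    by (rule nat_plus_int_eq_iff[symmetric])
  then show ?thesis
    unfolding s of_int_budget1[OF dvd0]
    by (auto simp: e1_def A1_def lift_diff_def exponent_lift_def algebra_simps)
qed

lemma orb_equation2_iff:
  fixes y' :: "nat \<Rightarrow> nat"
  assumes dvd0: "\<alpha>\<^sub>0 G dvd l1 + \<omega>2\<^sub>0 G * l2 - cbar c"
    and dvd2: "\<And>j. j \<in> {1..d2 G} \<Longrightarrow> \<alpha>2 G j dvd int (y' j) - remainder2 c l2 j"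
  shows "of_int l1 / of_int (\<alpha>\<^sub>0 G) + e2 G * of_int l2 = - A2 G (lift_diff (exponent_lift k y k' y') c)
    \<longleftrightarrow> int k' + (\<Sum>j=1..d2 G. (int (y' j) - remainder2 c l2 j) div \<alpha>2 G j) = budget2 c l1 l2"
proof -
  let ?r = "of_int :: int \<Rightarrow> rat"
  have "?r (\<Sum>j=1..d2 G. (int (y' j) - remainder2 c l2 j) div \<alpha>2 G j)
      = (\<Sum>j=1..d2 G. (of_nat (y' j) - ?r (c2 c j)) / ?r (\<alpha>2 G j) + ?r (\<omega>2 G j) / ?r (\<alpha>2 G j) * ?r l2)"
    unfolding of_int_sum
  proof (rule sum.cong[OF refl])
    fix i assume i: "i \<in> {1..d2 G}"
    show "?r ((int (y' i) - remainder2 c l2 i) div \<alpha>2 G i)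
        = (of_nat (y' i) - ?r (c2 c i)) / ?r (\<alpha>2 G i) + ?r (\<omega>2 G i) / ?r (\<alpha>2 G i) * ?r l2"
      unfolding of_int_div_eq[OF dvd2[OF i]]
      by (simp add: remainder2_def diff_divide_distrib add_divide_distrib)
  qed
  also have "\<dots> = (\<Sum>j=1..d2 G. (of_nat (y' j) - ?r (c2 c j)) / ?r (\<alpha>2 G j))
      + (\<Sum>j=1..d2 G. ?r (\<omega>2 G j) / ?r (\<alpha>2 G j)) * ?r l2"
    by (simp add: sum.distrib sum_distrib_right)
  finally have s: "?r (\<Sum>j=1..d2 G. (int (y' j) - remainder2 c l2 j) div \<alpha>2 G j) = \<dots>" .
  have "int k' + (\<Sum>j=1..d2 G. (int (y' j) - remainder2 c l2 j) div \<alpha>2 G j) = budget2 c l1 l2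
      \<longleftrightarrow> of_nat k' + ?r (\<Sum>j=1..d2 G. (int (y' j) - remainder2 c l2 j) div \<alpha>2 G j) = ?r (budget2 c l1 l2)"
    by (rule nat_plus_int_eq_iff[symmetric])
  then show ?thesis
    unfolding s of_int_budget2[OF dvd0]
    by (auto simp: e2_def A2_def lift_diff_def exponent_lift_def algebra_simps)
qed

text \<open>The node coordinates of the difference are \<open>(l1, l2)\<close> iff the orbifold equations hold for them, since
the orbifold matrix is injective; integrality is \<open>int_lattice_iff\<close>.\<close>

lemma exponents_iff:
  fixes k y k' y' c
  defines "x \<equiv> lift_element G (exponent_lift k y k' y')" and "r \<equiv> lift_element G c"
  assumes "y \<in> {1..d1 G} \<rightarrow>\<^sub>E UNIV" "y' \<in> {1..d2 G} \<rightarrow>\<^sub>E UNIV"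
  shows "(\<lambda>v. x v - r v) \<in> int_lattice
      \<and> x (node1 G) = of_int l1 + r (node1 G) \<and> x (node2 G) = of_int l2 + r (node2 G)
    \<longleftrightarrow> \<alpha>\<^sub>0 G dvd l1 + \<omega>2\<^sub>0 G * l2 - cbar c
      \<and> (k, y) \<in> exponents1 c l1 l2 \<and> (k', y') \<in> exponents2 c l1 l2" (is "?L \<longleftrightarrow> ?R")
proof -
  let ?m = "lift_diff (exponent_lift k y k' y') c"
  let ?z = "lift_element G ?m"
  let ?dvd0 = "\<alpha>\<^sub>0 G dvd l1 + \<omega>2\<^sub>0 G * l2 - cbar c"
  let ?dvd1 = "\<forall>i\<in>{1..d1 G}. \<alpha>1 G i dvd int (y i) - remainder1 c l1 i"
  let ?dvd2 = "\<forall>j\<in>{1..d2 G}. \<alpha>2 G j dvd int (y' j) - remainder2 c l2 j"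
  let ?eq1 = "e1 G * of_int l1 + of_int l2 / of_int (\<alpha>\<^sub>0 G) = - A1 G ?m"
  let ?eq2 = "of_int l1 / of_int (\<alpha>\<^sub>0 G) + e2 G * of_int l2 = - A2 G ?m"
  have z: "?z = (\<lambda>v. x v - r v)" by (simp add: lift_element_diff x_def r_def)
  have coords: "?z (node1 G) = of_int l1 \<and> ?z (node2 G) = of_int l2 \<longleftrightarrow> ?eq1 \<and> ?eq2"
    using orb_equations[of ?m] orb_injective[of "?z (node1 G)" "?z (node2 G)" "of_int l1" "of_int l2"]
    by auto
  have "?L \<longleftrightarrow> ?z \<in> int_lattice \<and> (?z (node1 G) = of_int l1 \<and> ?z (node2 G) = of_int l2)"
    unfolding z by (auto simp: algebra_simps)
  also have "\<dots> \<longleftrightarrow> (?dvd1 \<and> ?dvd2 \<and> ?dvd0) \<and> (?z (node1 G) = of_int l1 \<and> ?z (node2 G) = of_int l2)"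
  proof (cases "?z (node1 G) = of_int l1 \<and> ?z (node2 G) = of_int l2")
    case True
    have m: "c1 ?m i + \<omega>1 G i * l1 = int (y i) - remainder1 c l1 i"
      "c2 ?m i + \<omega>2 G i * l2 = int (y' i) - remainder2 c l2 i"
      "l1 + \<omega>2\<^sub>0 G * l2 + cbar ?m = l1 + \<omega>2\<^sub>0 G * l2 - cbar c" for i
      by (simp_all add: lift_diff_def exponent_lift_def remainder1_def remainder2_def)
    have "?z \<in> int_lattice \<longleftrightarrow> ?dvd1 \<and> ?dvd2 \<and> ?dvd0"
      using int_lattice_iff[of ?m l1 l2, unfolded m] True by blast
    then show ?thesis by simp
  qed blast
  also have "\<dots> \<longleftrightarrow> (?dvd1 \<and> ?dvd2 \<and> ?dvd0) \<and> (?eq1 \<and> ?eq2)" unfolding coords ..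
  also have "\<dots> \<longleftrightarrow> ?R"
    using orb_equation1_iff[of l1 l2 c y k k' y'] orb_equation2_iff[of l1 l2 c y' k y k'] assms(3,4)
    by (auto simp: exponents1_def exponents2_def)
  finally show ?thesis .
qed

lemma exponents1_sum:
  assumes "\<alpha>\<^sub>0 G dvd l1 + \<omega>2\<^sub>0 G * l2 - cbar c"
  shows "finite (exponents1 c l1 l2)"
    and "(\<Sum>(k, y)\<in>exponents1 c l1 l2. fps_nth ((1 - fps_X :: rat fps) ^ (d1 G - 1)) k)
      = (if N1 G c l1 l2 \<ge> 0 then 1 else 0)"
proof -
  have d: "d1 G \<ge> 1" using legs1(2) by simp
  note * = residue_sum[OF d invariants1(3), where \<rho> = "remainder1 c l1" and M = "budget1 c l1 l2"]
  show "finite (exponents1 c l1 l2)" unfolding exponents1_def using *(1) by simp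
  have "N1 G c l1 l2 = of_int (budget1 c l1 l2 + (\<Sum>i=1..d1 G. remainder1 c l1 i div \<alpha>1 G i))"
    unfolding of_int_add of_int_budget1[OF assms]
    unfolding N1_def remainder1_def floor_divide_of_int_eq of_int_sum ..
  then show "(\<Sum>(k, y)\<in>exponents1 c l1 l2. fps_nth ((1 - fps_X :: rat fps) ^ (d1 G - 1)) k)
      = (if N1 G c l1 l2 \<ge> 0 then 1 else 0)"
    unfolding exponents1_def using *(2) by (simp only: of_int_0_le_iff)
qed

lemma exponents2_sum:
  assumes "\<alpha>\<^sub>0 G dvd l1 + \<omega>2\<^sub>0 G * l2 - cbar c"
  shows "finite (exponents2 c l1 l2)"
    and "(\<Sum>(k, y)\<in>exponents2 c l1 l2. fps_nth ((1 - fps_X :: rat fps) ^ (d2 G - 1)) k)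
      = (if N2 G c l1 l2 \<ge> 0 then 1 else 0)"
proof -
  have d: "d2 G \<ge> 1" using legs2(2) by simp
  note * = residue_sum[OF d invariants2(3), where \<rho> = "remainder2 c l2" and M = "budget2 c l1 l2"]
  show "finite (exponents2 c l1 l2)" unfolding exponents2_def using *(1) by simp
  have "N2 G c l1 l2 = of_int (budget2 c l1 l2 + (\<Sum>j=1..d2 G. remainder2 c l2 j div \<alpha>2 G j))"
    unfolding of_int_add of_int_budget2[OF assms]
    unfolding N2_def remainder2_def floor_divide_of_int_eq of_int_sum ..
  then show "(\<Sum>(k, y)\<in>exponents2 c l1 l2. fps_nth ((1 - fps_X :: rat fps) ^ (d2 G - 1)) k)
      = (if N2 G c l1 l2 \<ge> 0 then 1 else 0)"
    unfolding exponents2_def using *(2) by (simp only: of_int_0_le_iff)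
qed

definition class_exponents ::
  "lift_vector \<Rightarrow> rat \<Rightarrow> rat \<Rightarrow> ((nat \<times> (nat \<Rightarrow> nat)) \<times> (nat \<times> (nat \<Rightarrow> nat))) set" where
  "class_exponents c a b = {((k, y), (k', y')). y \<in> {1..d1 G} \<rightarrow>\<^sub>E UNIV \<and> y' \<in> {1..d2 G} \<rightarrow>\<^sub>E UNIV
     \<and> (\<lambda>v. lift_element G (exponent_lift k y k' y') v - lift_element G c v) \<in> int_lattice
     \<and> lift_element G (exponent_lift k y k' y') (node1 G) = a
     \<and> lift_element G (exponent_lift k y k' y') (node2 G) = b}"

lemma class_exponents_eq:
  "class_exponents c (of_int l1 + lift_element G c (node1 G)) (of_int l2 + lift_element G c (node2 G))
    = (if \<alpha>\<^sub>0 G dvd l1 + \<omega>2\<^sub>0 G * l2 - cbar c then exponents1 c l1 l2 \<times> exponents2 c l1 l2 else {})"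
proof -
  have "((k, y), (k', y')) \<in> class_exponents c (of_int l1 + lift_element G c (node1 G))
        (of_int l2 + lift_element G c (node2 G))
      \<longleftrightarrow> \<alpha>\<^sub>0 G dvd l1 + \<omega>2\<^sub>0 G * l2 - cbar c
        \<and> (k, y) \<in> exponents1 c l1 l2 \<and> (k', y') \<in> exponents2 c l1 l2" for k y k' y'
  proof (cases "y \<in> {1..d1 G} \<rightarrow>\<^sub>E UNIV \<and> y' \<in> {1..d2 G} \<rightarrow>\<^sub>E UNIV")
    case True
    then show ?thesis using exponents_iff[of y y' k k' c l1 l2] by (simp add: class_exponents_def)
  next
    case False
    then show ?thesis by (auto simp: class_exponents_def exponents1_def exponents2_def)
  qed
  then show ?thesis by auto
qed

lemma class_exponents_coordinates:
  assumes "class_exponents c a b \<noteq> {}"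
  obtains l1 l2 where "a = of_int l1 + lift_element G c (node1 G)"
    "b = of_int l2 + lift_element G c (node2 G)"
proof -
  obtain x where x: "(\<lambda>v. x v - lift_element G c v) \<in> int_lattice" "x (node1 G) = a" "x (node2 G) = b"
    using assms by (auto simp: class_exponents_def)
  have int: "x v - lift_element G c v \<in> \<int>" for v using x(1) by (simp add: int_lattice_def)
  obtain l1 l2 where "x (node1 G) - lift_element G c (node1 G) = of_int l1"
    "x (node2 G) - lift_element G c (node2 G) = of_int l2"
    using int by (metis Ints_cases)
  then show thesis using that[of l1 l2] x by (simp add: algebra_simps)
qed

text \<open>The coefficient is a sum over vectors; it is reindexed by the exponents at the nodes and at the ends of
the legs, where the finite index set may contain some with vanishing coefficient.\<close>

lemma Zh_reduced_eq_sum: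
  assumes h: "is_lift G h c" and fin: "finite (class_exponents c a b)"
  shows "Zh_reduced G h (node1 G) (node2 G) (a, b)
    = (\<Sum>((k, y), (k', y'))\<in>class_exponents c a b.
        fps_nth ((1 - fps_X) ^ (d1 G - 1)) k * fps_nth ((1 - fps_X) ^ (d2 G - 1)) k')"
proof -
  let ?\<phi> = "\<lambda>((k, y), (k', y')). lift_element G (exponent_lift k y k' y')"
  let ?T = "class_exponents c a b"
  let ?L = "{x. Zh_coeff G h x \<noteq> 0 \<and> x (node1 G) = a \<and> x (node2 G) = b}"
  have in_class: "disc_class G x = h \<longleftrightarrow> (\<lambda>v. x v - lift_element G c v) \<in> int_lattice"
    if "x \<in> dual_lattice G" for x
    using disc_class_eq_iff[OF that lift_in_dual_lattice[of c]] h by (simp add: is_lift_def)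
  have inj: "inj_on ?\<phi> ?T"
  proof (rule inj_onI)
    fix s t assume st: "s \<in> ?T" "t \<in> ?T" "?\<phi> s = ?\<phi> t"
    obtain k y k' y' l z l' z' where eq: "s = ((k, y), (k', y'))" "t = ((l, z), (l', z'))"
      by (metis surj_pair)
    have "lift_element G (exponent_lift k y k' y') = lift_element G (exponent_lift l z l' z')"
      using st(3) unfolding eq by simp
    note * = exponent_lift_inj[OF this]
    have "y \<in> {1..d1 G} \<rightarrow>\<^sub>E UNIV" "z \<in> {1..d1 G} \<rightarrow>\<^sub>E UNIV"
      "y' \<in> {1..d2 G} \<rightarrow>\<^sub>E UNIV" "z' \<in> {1..d2 G} \<rightarrow>\<^sub>E UNIV"
      using st(1,2) unfolding eq class_exponents_def by simp_all
    then show "s = t" unfolding eq using * by blast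
  qed
  have sub: "?L \<subseteq> ?\<phi> ` ?T"
  proof
    fix x assume x: "x \<in> ?L"
    then have dual: "x \<in> dual_lattice G" and cl: "disc_class G x = h" and Z: "Z_coeff G x \<noteq> 0"
      by (auto simp: Zh_coeff_def split: if_splits)
    obtain k y k' y' where y: "y \<in> {1..d1 G} \<rightarrow>\<^sub>E UNIV" "y' \<in> {1..d2 G} \<rightarrow>\<^sub>E UNIV"
      and xeq: "x = lift_element G (exponent_lift k y k' y')"
      by (rule Z_coeff_support[OF Z])
    have "((k, y), (k', y')) \<in> ?T"
      using y x in_class[OF dual] cl unfolding class_exponents_def xeq by simp
    then show "x \<in> ?\<phi> ` ?T" by (rule rev_image_eqI) (simp add: xeq)
  qed
  have zero: "Zh_coeff G h x = 0" if "x \<in> ?\<phi> ` ?T - ?L" for x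
    using that by (auto simp: class_exponents_def)
  have "Zh_reduced G h (node1 G) (node2 G) (a, b) = (\<Sum>x\<in>?\<phi> ` ?T. Zh_coeff G h x)"
    unfolding Zh_reduced_def prod.case
    by (rule sum.mono_neutral_left[OF finite_imageI[OF fin] sub]) (rule ballI, rule zero)
  also have "\<dots> = (\<Sum>t\<in>?T. Zh_coeff G h (?\<phi> t))" by (rule sum.reindex[OF inj, unfolded comp_def])
  also have "\<dots> = (\<Sum>((k, y), (k', y'))\<in>?T.
        fps_nth ((1 - fps_X) ^ (d1 G - 1)) k * fps_nth ((1 - fps_X) ^ (d2 G - 1)) k')"
  proof (rule sum.cong[OF refl])
    fix t assume t: "t \<in> ?T"
    obtain k y k' y' where t_eq: "t = ((k, y), (k', y'))" by (metis surj_pair)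
    have "disc_class G (lift_element G (exponent_lift k y k' y')) = h"
      using t in_class[OF lift_in_dual_lattice] by (simp add: t_eq class_exponents_def)
    then show "Zh_coeff G h (?\<phi> t) = (\<lambda>((k, y), (k', y')).
        fps_nth ((1 - fps_X) ^ (d1 G - 1)) k * fps_nth ((1 - fps_X) ^ (d2 G - 1)) k') t"
      by (simp add: t_eq Zh_coeff_def lift_in_dual_lattice Z_coeff_exponent_lift)
  qed
  finally show ?thesis .
qed

lemma monomial_sum_eq:
  fixes \<rho>1 \<rho>2 :: rat
  shows "monomial_sum S (\<lambda>(l1, l2). (of_int l1 + \<rho>1, of_int l2 + \<rho>2)) (of_int l1 + \<rho>1, of_int l2 + \<rho>2)
    = (if (l1, l2) \<in> S then 1 else 0)"
proof -
  have "{s \<in> S. (case s of (l1, l2) \<Rightarrow> (of_int l1 + \<rho>1, of_int l2 + \<rho>2)) = (of_int l1 + \<rho>1, of_int l2 + \<rho>2)}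
      = (if (l1, l2) \<in> S then {(l1, l2)} else {})"
    by auto
  then show ?thesis by (simp add: monomial_sum_def)
qed

lemma Zh_reduced_eq:
  assumes h: "is_lift G h c"
  shows "Zh_reduced G h (node1 G) (node2 G) (a, b) = monomial_sum (lift_support G c)
    (\<lambda>(l1, l2). (of_int l1 + lift_element G c (node1 G), of_int l2 + lift_element G c (node2 G))) (a, b)"
proof (cases "\<exists>l1 l2. a = of_int l1 + lift_element G c (node1 G) \<and> b = of_int l2 + lift_element G c (node2 G)")
  case True
  then obtain l1 l2 where a: "a = of_int l1 + lift_element G c (node1 G)"
    and b: "b = of_int l2 + lift_element G c (node2 G)" by blast
  let ?dvd = "\<alpha>\<^sub>0 G dvd l1 + \<omega>2\<^sub>0 G * l2 - cbar c"
  have fin: "finite (class_exponents c a b)"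
    unfolding a b class_exponents_eq using exponents1_sum(1) exponents2_sum(1) by auto
  have "Zh_reduced G h (node1 G) (node2 G) (a, b)
      = (if ?dvd \<and> N1 G c l1 l2 \<ge> 0 \<and> N2 G c l1 l2 \<ge> 0 then 1 else 0)"
  proof (cases ?dvd)
    case True
    have "Zh_reduced G h (node1 G) (node2 G) (a, b)
      = (\<Sum>(k, y)\<in>exponents1 c l1 l2. fps_nth ((1 - fps_X :: rat fps) ^ (d1 G - 1)) k)
        * (\<Sum>(k', y')\<in>exponents2 c l1 l2. fps_nth ((1 - fps_X :: rat fps) ^ (d2 G - 1)) k')"
      unfolding Zh_reduced_eq_sum[OF h fin] unfolding a b class_exponents_eq sum_product
      using True by (simp add: sum.cartesian_product case_prod_unfold)
    then show ?thesis unfolding exponents1_sum(2)[OF True] exponents2_sum(2)[OF True] using True by simp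
  next
    case False
    then show ?thesis unfolding Zh_reduced_eq_sum[OF h fin] unfolding a b class_exponents_eq by simp
  qed
  also have "\<dots> = (if (l1, l2) \<in> lift_support G c then 1 else 0)"
    by (auto simp: lift_support_def cong_iff_dvd_diff)
  finally show ?thesis unfolding a b monomial_sum_eq .
next
  case False
  then have empty: "class_exponents c a b = {}" using class_exponents_coordinates by metis
  then have "Zh_reduced G h (node1 G) (node2 G) (a, b) = 0"
    using Zh_reduced_eq_sum[OF h, of a b] by simp
  moreover have "{s \<in> lift_support G c. (case s of (l1, l2) \<Rightarrow>
      (of_int l1 + lift_element G c (node1 G), of_int l2 + lift_element G c (node2 G))) = (a, b)} = {}"
    using False by auto
  ultimately show ?thesis unfolding monomial_sum_def by (simp only: card.empty of_nat_0)
qed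

end

theorem theorem5p2p2p1:
  fixes G :: "('v::finite) two_node_graph"
    and h :: "('v \<Rightarrow> rat) set"
    and c :: lift_vector
  assumes "two_node_tree G"
    and "h \<in> discriminant_group G"
    and "is_lift G h c"
  shows "Zh_reduced G h (node1 G) (node2 G) =
    monomial_sum (lift_support G c)
      (\<lambda>(l1, l2). (of_int l1 + node_coeffs G c $ 0, of_int l2 + node_coeffs G c $ 1))"
proof -
  interpret two_node_plumbing G by unfold_locales (rule assms(1))
  show ?thesis
    unfolding node_coeffs_eq using Zh_reduced_eq[OF assms(3)] by (auto simp: fun_eq_iff)
qed

end
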